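(* Consider an $M$-step Adams--Moulton scheme with order $p=M+1$. Let $p_{\rm AM}(z)=\beta_0z^M+\beta_1z^{M-1}+\cdots+\beta_M$ and assume that $p_{\rm AM}(\lambda)\ne0$ for every $\lambda\in\mathbb{C}$ with $|\lambda|=1$. Let $\hat R>0$ be independent of $h$, and let $u_h\in\mathcal{A}_{\hat R}$ be a zero-residual solution of the non-auxiliary loss, i.e. $J_h(u_h)=0$. Then $$\int_0^T|u_h(\mathbf{x}(t))-f(\mathbf{x}(t))|\,dt\le C_M\big(h(E_0+E_T)+h^p+h^p\hat R\big),$$ where $E_0=\sum_{j=0}^{M-1}|u_h(\mathbf{x}_j)-f(\mathbf{x}_j)|$, $E_T=\sum_{j=N-M+1}^{N}|u_h(\mathbf{x}_j)-f(\mathbf{x}_j)|$, and $C_M$ is independent of $h$, $u_h$, $E_0$, $E_T$ and $\hat R$. Moreover, suppose that the boundary layer errors $E_0$ and $E_T$ remain bounded as $h\to0^+$. Set (with $\max\emptyset=0$) $$\rho_{\rm AM}:=\max\Big\{\max_{p_{\rm AM}(\lambda)=0,\ |\lambda|<1}|\lambda|,\ \max_{p_{\rm AM}(\lambda)=0,\ |\lambda|>1}|\lambda|^{-1}\Big\}.$$ Then, for every fixed $\delta\in(0,T/2)$ and $\theta\in(\rho_{\rm AM},1)$, there exists $\hat h>0$ such that, for all $0<h<\hat h$, $$\int_\delta^{T-\delta}|u_h(\mathbf{x}(t))-f(\mathbf{x}(t))|\,dt\le C_{M,\theta}\,(C+\hat R)\,h^p,$$ where the constants $C_{M,\theta}$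 and $C$ are independent of $h$ and $\hat R$.
   Context: Data. $\mathbf{x}:[0,T]\to\mathbb{R}^d$ is a sufficiently smooth solution of $\dot{\mathbf{x}}=\mathbf{f}(\mathbf{x})$, $\mathbf{x}(0)=\mathbf{x}_{\rm init}$ (smooth enough for the order-$p$ truncation estimate; $\mathbf{x}\in C^{p+1}([0,T])^d$). For $N\in\mathbb{N}$, $N\ge M$, put $h=T/N$ (so $h$ ranges over the values $T/N$), $t_n=nh$, $\mathbf{x}_n=\mathbf{x}(t_n)$, $0\le n\le N$. $f$ denotes one fixed scalar component of $\mathbf{f}$ and $x_n$ the corresponding scalar component of $\mathbf{x}_n$. $\Omega_{\mathcal{T}}\subset\mathbb{R}^d$ is a fixed neighborhood of the trajectory $\mathcal{T}=\{\mathbf{x}(t):0\le t\le T\}$, and the admissible class $\mathcal{A}$ is a subset of $C(\Omega_{\mathcal{T}})$. Scheme. The $M$-step Adams--Moulton (A-M) scheme ($M\ge1$) is $x_n-x_{n-1}=h\sum_{m=0}^M\beta_mf_{n-m}$ (so $\alpha_0=1,\alpha_1=-1$, other $\alpha_m=0$) with $\beta_m=\frac{(-1)^m}{m!(M-m)!}\int_0^1\prod_{i=0,i\ne m}^{M}(u+i-1)\,du$, $0\le m\le M$; in particular $\beta_0\ne0$. Non-auxiliary loss. For $u\in\mathcal{A}$, $$J_h(u)=\frac1{N-M+1}\sum_{n=M}^N\Big|\sum_{m=0}^M\beta_mu(\mathbf{x}_{n-m})-h^{-1}\sum_{m=0}^M\alpha_mx_{n-m}\Big|^2 .$$ Trace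 regularity class. For $\hat R>0$, $\mathcal{A}_{\hat R}$ is the set of $u\in\mathcal{A}$ such that $g(t)=u(\mathbf{x}(t))-f(\mathbf{x}(t))$ belongs to the Sobolev space $W^{p,1}(0,T)$ with seminorm $|g|_{W^{p,1}(0,T)}=\|g^{(p)}\|_{L^1(0,T)}\le\hat R$. *)

theory Defs
  imports "HOL-Analysis.Analysis" "HOL-Computational_Algebra.Polynomial"
begin

section \<open>Regularity classes\<close>

text \<open>
  The class \<open>C\<^sup>k(S)\<close> for vector-valued functions of a real variable. On a closed interval the
  derivatives at the end points are one-sided (\<open>at t within S\<close>).
\<close>

definition Ck_on :: "nat \<Rightarrow> real set \<Rightarrow> (real \<Rightarrow> 'a::real_normed_vector) \<Rightarrow> bool" where
  "Ck_on k S g \<longleftrightarrow>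
     (\<exists>D. (\<forall>t\<in>S. D 0 t = g t)
        \<and> (\<forall>j<k. \<forall>t\<in>S. (D j has_vector_derivative D (Suc j) t) (at t within S))
        \<and> continuous_on S (D k))"

text \<open>Test functions: \<open>C\<^sub>c\<^sup>\<infinity>(a,b)\<close>, with values extended by zero to the real line.\<close>

definition test_fun :: "real \<Rightarrow> real \<Rightarrow> (real \<Rightarrow> real) \<Rightarrow> bool" where
  "test_fun a b \<phi> \<longleftrightarrow>
     (\<forall>k t. ((deriv ^^ k) \<phi>) differentiable (at t))
   \<and> (\<exists>K. compact K \<and> K \<subseteq> {a<..<b} \<and> (\<forall>t. t \<notin> K \<longrightarrow> \<phi> t = 0))"

text \<open>\<open>v \<in> L\<^sup>1(a,b)\<close> is a \<open>k\<close>-th weak derivative of \<open>g\<close> on \<open>(a,b)\<close>.\<close>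

definition has_weak_deriv :: "real \<Rightarrow> real \<Rightarrow> nat \<Rightarrow> (real \<Rightarrow> real) \<Rightarrow> (real \<Rightarrow> real) \<Rightarrow> bool" where
  "has_weak_deriv a b k g v \<longleftrightarrow>
     v absolutely_integrable_on {a<..<b}
   \<and> (\<forall>\<phi>. test_fun a b \<phi> \<longrightarrow>
        integral {a<..<b} (\<lambda>t. g t * (deriv ^^ k) \<phi> t)
        = (- 1) ^ k * integral {a<..<b} (\<lambda>t. v t * \<phi> t))"

definition sobolev_W1 :: "real \<Rightarrow> real \<Rightarrow> nat \<Rightarrow> (real \<Rightarrow> real) set" where
  "sobolev_W1 a b p =
     {g. g absolutely_integrable_on {a<..<b} \<and> (\<forall>k\<in>{1..p}. \<exists>v. has_weak_deriv a b k g v)}"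

text \<open>
  The seminorm \<open>\<parallel>g\<^sup>(\<^sup>p\<^sup>)\<parallel>\<close> in \<open>L\<^sup>1(a,b)\<close>. Weak derivatives are unique up to null sets, so the choice
  of representative is immaterial. Only meaningful for members of \<^const>\<open>sobolev_W1\<close>.
\<close>

definition sobolev_seminorm :: "real \<Rightarrow> real \<Rightarrow> nat \<Rightarrow> (real \<Rightarrow> real) \<Rightarrow> real" where
  "sobolev_seminorm a b p g = integral {a<..<b} (\<lambda>t. \<bar>(SOME v. has_weak_deriv a b p g v) t\<bar>)"

section \<open>The Adams--Moulton scheme\<close>

definition AM_alpha :: "nat \<Rightarrow> real" where
  "AM_alpha m = (if m = 0 then 1 else if m = 1 then - 1 else 0)"

definition AM_beta :: "nat \<Rightarrow> nat \<Rightarrow> real" where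
  "AM_beta M m = (- 1) ^ m / (fact m * fact (M - m))
     * integral {0..1} (\<lambda>u. \<Prod>i\<in>{0..M} - {m}. u + real i - 1)"

definition AM_poly :: "nat \<Rightarrow> complex poly" where
  "AM_poly M = (\<Sum>m=0..M. monom (complex_of_real (AM_beta M m)) (M - m))"

text \<open>Maximum with the convention \<open>max \<emptyset> = 0\<close>; used only for finite sets.\<close>

definition Max0 :: "real set \<Rightarrow> real" where
  "Max0 S = (if S = {} then 0 else Max S)"

definition AM_rho :: "nat \<Rightarrow> real" where
  "AM_rho M = max
     (Max0 {cmod z | z. poly (AM_poly M) z = 0 \<and> cmod z < 1})
     (Max0 {inverse (cmod z) | z. poly (AM_poly M) z = 0 \<and> cmod z > 1})"

section \<open>Grid, loss and boundary layer errors\<close>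

definition step :: "real \<Rightarrow> nat \<Rightarrow> real" where
  "step T N = T / real N"

definition node :: "real \<Rightarrow> nat \<Rightarrow> nat \<Rightarrow> real" where
  "node T N n = real n * step T N"

text \<open>
  In the remaining definitions \<open>x\<close> is the full trajectory in \<open>\<real>\<^sup>d\<close>, \<open>i\<close> selects the scalar component
  under consideration, and \<open>f\<close> (respectively \<open>u\<close>) is a scalar function on the state space.
\<close>

definition AM_loss ::
  "nat \<Rightarrow> real \<Rightarrow> nat \<Rightarrow> (real \<Rightarrow> real ^ 'd) \<Rightarrow> 'd \<Rightarrow> (real ^ 'd \<Rightarrow> real) \<Rightarrow> real" where
  "AM_loss M T N x i u =
     1 / real (N - M + 1) *
     (\<Sum>n=M..N. \<bar>(\<Sum>m=0..M. AM_beta M m * u (x (node T N (n - m))))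
                - inverse (step T N) * (\<Sum>m=0..M. AM_alpha m * (x (node T N (n - m)) $ i))\<bar>\<^sup>2)"

definition trace_class ::
  "real \<Rightarrow> nat \<Rightarrow> (real \<Rightarrow> real ^ 'd) \<Rightarrow> (real ^ 'd \<Rightarrow> real) \<Rightarrow> (real ^ 'd \<Rightarrow> real) set \<Rightarrow> real
    \<Rightarrow> (real ^ 'd \<Rightarrow> real) set" where
  "trace_class T p x f A R =
     {u \<in> A. (\<lambda>t. u (x t) - f (x t)) \<in> sobolev_W1 0 T p
           \<and> sobolev_seminorm 0 T p (\<lambda>t. u (x t) - f (x t)) \<le> R}"

definition err_0 ::
  "nat \<Rightarrow> real \<Rightarrow> nat \<Rightarrow> (real \<Rightarrow> real ^ 'd) \<Rightarrow> (real ^ 'd \<Rightarrow> real) \<Rightarrow> (real ^ 'd \<Rightarrow> real) \<Rightarrow> real" where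
  "err_0 M T N x f u = (\<Sum>j=0..<M. \<bar>u (x (node T N j)) - f (x (node T N j))\<bar>)"

definition err_T ::
  "nat \<Rightarrow> real \<Rightarrow> nat \<Rightarrow> (real \<Rightarrow> real ^ 'd) \<Rightarrow> (real ^ 'd \<Rightarrow> real) \<Rightarrow> (real ^ 'd \<Rightarrow> real) \<Rightarrow> real" where
  "err_T M T N x f u = (\<Sum>j=N-M+1..N. \<bar>u (x (node T N j)) - f (x (node T N j))\<bar>)"

end

theory Submission
  imports Defs "HOL-Computational_Algebra.Fundamental_Theorem_Algebra"
begin

text \<open>
  Write \<open>g(t) = u(x(t)) - f(x(t))\<close>, \<open>h = T / N\<close> and \<open>e\<^sub>k = g(k h)\<close>. The proof has two independent halves: the
  nodal errors \<open>e\<^sub>k\<close> are small, and \<open>g\<close> is controlled between the nodes by the nodal errors.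

  Nodal errors. Because the loss vanishes, \<open>u\<close> satisfies the scheme exactly at the nodes, while \<open>f\<close> satisfies it up to the
  truncation error. As the scheme integrates polynomials of degree \<open>M\<close> exactly, Taylor expansion bounds that
  error by a multiple of \<open>h^p\<close> (\<open>AM_truncation_error\<close>). Hence
  \<open>\<beta>\<^sub>0 e\<^sub>n + \<dots> + \<beta>\<^sub>M e\<^sub>n\<^sub>-\<^sub>M = O(h^p)\<close>, a recurrence whose characteristic polynomial has no root of modulus one. Such a
  recurrence factors into first-order ones; a factor with root inside the unit disc is solved forwards from the left
  boundary layer, one with root outside is solved backwards from the right boundary layer. Both directions
  contract, which gives \<open>\<bar>e\<^sub>k\<bar> \<le> K (h^p + \<theta>^k E\<^sub>0 + \<theta>^(N-k) E\<^sub>T)\<close> for each \<open>\<theta>\<close> strictly between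
  \<open>AM_rho M\<close> and \<open>1\<close> (\<open>hyperbolic_recurrence_bound\<close>, \<open>AM_node_error_bound\<close>). The gap between \<open>\<theta>\<close> and the root moduli
  absorbs the polynomial factors that multiple roots would produce.

  Between the nodes. On a block of \<open>M + 1\<close> consecutive nodes, \<open>g\<close> minus its Lagrange interpolant at a point is a
  combination of point values of \<open>g\<close> that vanishes on polynomials of degree less than \<open>p\<close>. Such a combination is at
  most a constant times \<open>h^(p-1)\<close> times the \<open>L\<^sup>1\<close> norm of the weak derivative of order \<open>p\<close> over the block
  (\<open>annihilating_functional_bound\<close>). The reason is a mollified Peano kernel: replace the point masses
  by bumps and integrate the result \<open>p\<close> times from the left; since the combination kills polynomials, this repeated primitive
  vanishes on the right as well, so it is a test function and the definition of the weak derivative applies to it.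
  Integrating over the cells and summing gives \<open>integral_bound_from_nodes\<close>.

  Both estimates of the theorem follow by summation (\<open>zero_residual_integral_bound\<close>). Over all of \<open>[0, T]\<close> the geometric
  series contribute \<open>h (E\<^sub>0 + E\<^sub>T)\<close>. At distance \<open>\<delta>\<close> from the ends at least about \<open>\<delta> / h\<close> steps separate a node from the
  boundary layers, and \<open>\<theta>^(\<delta> / h)\<close> decays faster than every power of \<open>h\<close>.
\<close>

section \<open>Smooth functions and mollifiers\<close>

definition smooth_fun :: "(real \<Rightarrow> real) \<Rightarrow> bool" where
  "smooth_fun f \<longleftrightarrow> (\<forall>k t. (deriv ^^ k) f differentiable (at t))"

text \<open>
  The iterated derivatives never leave a set that is closed under differentiation, so membership in such a set proves
  smoothness without any formula for the derivatives of higher order.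
\<close>

lemma smooth_fun_coinduct:
  assumes "f \<in> S"
    and S: "\<And>g. g \<in> S \<Longrightarrow> \<exists>g'\<in>S. \<forall>t. (g has_real_derivative g' t) (at t)"
  shows "smooth_fun f"
proof -
  have "deriv g \<in> S" if "g \<in> S" for g
  proof -
    from S[OF that] obtain g' where g': "g' \<in> S" "\<And>t. (g has_real_derivative g' t) (at t)"
      by blast
    have "deriv g = g'" using g'(2) by (auto intro: DERIV_imp_deriv)
    with g'(1) show ?thesis by simp
  qed
  then have "(deriv ^^ k) f \<in> S" for k
    by (induction k) (use assms(1) in auto)
  then show ?thesis
    unfolding smooth_fun_def using S by (metis real_differentiable_def)
qed

lemma smooth_fun_deriv: "smooth_fun f \<Longrightarrow> smooth_fun (deriv f)"
  unfolding smooth_fun_def by (metis comp_apply funpow_Suc_right)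

lemma smooth_fun_has_deriv: "smooth_fun f \<Longrightarrow> (f has_real_derivative deriv f t) (at t)"
  unfolding smooth_fun_def
  by (metis DERIV_imp_deriv funpow_0 real_differentiable_def)

lemma smooth_fun_antideriv:
  assumes "\<And>t. (f has_real_derivative f' t) (at t)" "smooth_fun f'"
  shows "smooth_fun f"
proof -
  have [simp]: "deriv f = f'" using assms(1) by (auto intro: DERIV_imp_deriv)
  have "(deriv ^^ k) f differentiable (at t)" for k t
  proof (cases k)
    case 0
    then show ?thesis using assms(1) by (auto simp: real_differentiable_def)
  next
    case (Suc j)
    then show ?thesis using assms(2) by (simp add: funpow_Suc_right smooth_fun_def del: funpow.simps)
  qed
  then show ?thesis by (simp add: smooth_fun_def)
qed

lemma smooth_fun_affine:
  assumes "smooth_fun f"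
  shows "smooth_fun (\<lambda>t. c * f (a * t + b))"
proof (rule smooth_fun_coinduct[where S = "{\<lambda>t. c * g (a * t + b) | c g. smooth_fun g}"])
  fix h assume "h \<in> {\<lambda>t. c * g (a * t + b) | c g. smooth_fun g}"
  then obtain c g where h: "h = (\<lambda>t. c * g (a * t + b))" "smooth_fun g" by blast
  have "(h has_real_derivative (c * a) * deriv g (a * t + b)) (at t)" for t
    unfolding h(1)
    by (rule derivative_eq_intros DERIV_chain2[OF smooth_fun_has_deriv[OF h(2)]] | simp)+
  moreover have "(\<lambda>t. (c * a) * deriv g (a * t + b)) \<in> {\<lambda>t. c * g (a * t + b) | c g. smooth_fun g}"
    using smooth_fun_deriv[OF h(2)] by blast
  ultimately show "\<exists>g'\<in>{\<lambda>t. c * g (a * t + b) | c g. smooth_fun g}.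
      \<forall>t. (h has_real_derivative g' t) (at t)" by (intro bexI allI)
qed (use assms in blast)

text \<open>
  The products of two smooth functions are not closed under differentiation, but their finite sums are, by the product rule.
\<close>

inductive_set prod_sums :: "(real \<Rightarrow> real) set" where
  "smooth_fun f \<Longrightarrow> smooth_fun g \<Longrightarrow> (\<lambda>t. f t * g t) \<in> prod_sums"
| "f \<in> prod_sums \<Longrightarrow> g \<in> prod_sums \<Longrightarrow> (\<lambda>t. f t + g t) \<in> prod_sums"

lemma prod_sums_smooth: "f \<in> prod_sums \<Longrightarrow> smooth_fun f"
proof (rule smooth_fun_coinduct[where S = prod_sums])
  fix g assume "g \<in> prod_sums"
  then show "\<exists>g'\<in>prod_sums. \<forall>t. (g has_real_derivative g' t) (at t)"
  proof induction
    case (1 f g)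
    have "((\<lambda>t. f t * g t) has_real_derivative deriv f t * g t + f t * deriv g t) (at t)" for t
      using DERIV_mult[OF smooth_fun_has_deriv[OF 1(1)] smooth_fun_has_deriv[OF 1(2)]]
      by (simp add: algebra_simps)
    moreover have "(\<lambda>t. deriv f t * g t + f t * deriv g t) \<in> prod_sums"
      using 1 by (intro prod_sums.intros smooth_fun_deriv)
    ultimately show ?case by (intro bexI allI)
  next
    case (2 f g)
    then obtain f' g' where "f' \<in> prod_sums" "g' \<in> prod_sums"
      and D: "\<And>t. (f has_real_derivative f' t) (at t)" "\<And>t. (g has_real_derivative g' t) (at t)"
      by blast
    then have "(\<lambda>t. f' t + g' t) \<in> prod_sums" by (intro prod_sums.intros(2))
    moreover have "((\<lambda>t. f t + g t) has_real_derivative f' t + g' t) (at t)" for t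
      by (intro DERIV_add D)
    ultimately show ?case by (intro bexI allI)
  qed
qed

lemma smooth_fun_mult: "smooth_fun f \<Longrightarrow> smooth_fun g \<Longrightarrow> smooth_fun (\<lambda>t. f t * g t)"
  by (rule prod_sums_smooth, rule prod_sums.intros(1))

lemma smooth_fun_const: "smooth_fun (\<lambda>t. c)"
  by (rule smooth_fun_coinduct[where S = "range (\<lambda>c t. c)"]) (auto intro!: derivative_eq_intros)

lemma smooth_fun_add:
  assumes "smooth_fun f" "smooth_fun g" shows "smooth_fun (\<lambda>t. f t + g t)"
  using prod_sums_smooth[OF prod_sums.intros(2)[OF prod_sums.intros(1)[OF assms(1) smooth_fun_const[of 1]]
    prod_sums.intros(1)[OF assms(2) smooth_fun_const[of 1]]]] by simp

lemma smooth_fun_sum: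
  assumes "finite I" "\<And>i. i \<in> I \<Longrightarrow> smooth_fun (f i)"
  shows "smooth_fun (\<lambda>t. \<Sum>i\<in>I. f i t)"
  using assms by (induction I) (auto intro: smooth_fun_const smooth_fun_add)

lemma poly_over_exp_tendsto_0: "((\<lambda>y. poly q y / exp y) \<longlongrightarrow> (0::real)) at_top"
proof -
  have "((\<lambda>y::real. \<Sum>i\<le>degree q. coeff q i * (y ^ i / exp y)) \<longlongrightarrow> (\<Sum>i\<le>degree q. coeff q i * 0)) at_top"
    by (intro tendsto_intros tendsto_power_div_exp_0)
  then show ?thesis by (simp add: poly_altdef sum_divide_distrib)
qed

text \<open>
  For \<open>q = 1\<close> this is the classical function that is smooth at \<open>0\<close> but not analytic. Admitting an arbitrary polynomial
  \<open>q\<close> makes the family closed under differentiation: \<open>q\<close> turns into \<open>y\<^sup>2 (q(y) - q'(y))\<close>.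
\<close>

definition flat_fun :: "real poly \<Rightarrow> real \<Rightarrow> real" where
  "flat_fun q t = (if t > 0 then poly q (1 / t) * exp (- (1 / t)) else 0)"

lemma smooth_flat_fun: "smooth_fun (flat_fun q)"
proof (rule smooth_fun_coinduct[where S = "range flat_fun"])
  fix g assume "g \<in> range flat_fun"
  then obtain q where g: "g = flat_fun q" by blast
  define q' where "q' = [:0, 0, 1:] * (q - pderiv q)"
  have "(flat_fun q has_real_derivative flat_fun q' t) (at t)" for t
  proof (cases "t = 0")
    case True
    have "((\<lambda>h. flat_fun q h / h) \<longlongrightarrow> 0) (at_left 0)"
      by (rule tendsto_eventually)
        (auto simp: flat_fun_def eventually_at_filter)
    moreover have "((\<lambda>h. flat_fun q h / h) \<longlongrightarrow> 0) (at_right 0)"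
    proof -
      have "((\<lambda>h. poly ([:0, 1:] * q) (inverse h) / exp (inverse h)) \<longlongrightarrow> 0) (at_right 0)"
        by (rule filterlim_compose[OF poly_over_exp_tendsto_0 filterlim_inverse_at_top_right])
      then show ?thesis
        by (rule Lim_transform_eventually)
          (auto simp: eventually_at_filter flat_fun_def exp_minus field_simps)
    qed
    ultimately have "((\<lambda>h. flat_fun q h / h) \<longlongrightarrow> 0) (at 0)"
      by (simp add: filterlim_split_at_real)
    then show ?thesis using True
      by (simp add: has_field_derivative_iff flat_fun_def)
  next
    case False
    then consider "t < 0" | "t > 0" by linarith
    then show ?thesis
    proof cases
      case 1
      show ?thesis
        by (rule has_field_derivative_transform_within_open[where f = "\<lambda>t. 0" and S = "{..<0}"])
          (use 1 in \<open>auto simp: flat_fun_def\<close>)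
    next
      case 2
      have inv: "((\<lambda>t. 1 / t) has_real_derivative - (1 / t\<^sup>2)) (at t)"
        using 2 by (auto intro!: derivative_eq_intros simp: power2_eq_square)
      have "((\<lambda>t. poly q (1 / t) * exp (- (1 / t))) has_real_derivative
          (poly (pderiv q) (1 / t) * - (1 / t\<^sup>2)) * exp (- (1 / t))
          + (exp (- (1 / t)) * - (- (1 / t\<^sup>2))) * poly q (1 / t)) (at t)"
        by (intro DERIV_mult DERIV_chain2[OF poly_DERIV inv] DERIV_fun_exp DERIV_minus inv)
      also have "(poly (pderiv q) (1 / t) * - (1 / t\<^sup>2)) * exp (- (1 / t))
          + (exp (- (1 / t)) * - (- (1 / t\<^sup>2))) * poly q (1 / t) = flat_fun q' t"
        using 2 by (simp add: flat_fun_def q'_def field_simps power2_eq_square)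
      finally have "((\<lambda>t. poly q (1 / t) * exp (- (1 / t))) has_real_derivative flat_fun q' t) (at t)" .
      then show ?thesis
        by (rule has_field_derivative_transform_within_open[where S = "{0<..}"])
          (use 2 in \<open>auto simp: flat_fun_def\<close>)
    qed
  qed
  then show "\<exists>g'\<in>range flat_fun. \<forall>t. (g has_real_derivative g' t) (at t)"
    using g by blast
qed auto

lemma smooth_fun_continuous_on: "smooth_fun f \<Longrightarrow> continuous_on S f"
  by (meson DERIV_isCont continuous_at_imp_continuous_on smooth_fun_has_deriv)

text \<open>
  The product of two flat functions, one vanishing to the left of \<open>-r\<close> and one vanishing to the right of \<open>r\<close>, scaled to unit mass.
\<close>

lemma obtain_mollifier:
  assumes "r > (0::real)"
  obtains \<eta> where "smooth_fun \<eta>" "\<And>t. \<eta> t \<ge> 0" "\<And>t. \<bar>t\<bar> \<ge> r \<Longrightarrow> \<eta> t = 0" "integral {-r..r} \<eta> = 1"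
proof -
  define \<zeta> where "\<zeta> t = flat_fun 1 (r + t) * flat_fun 1 (r - t)" for t
  have sm: "smooth_fun \<zeta>"
    unfolding \<zeta>_def
    using smooth_fun_mult[OF smooth_fun_affine[OF smooth_flat_fun, of 1 1 1 r] smooth_fun_affine[OF smooth_flat_fun, of 1 1 "-1" r]]
    by (simp add: add.commute)
  have nn: "\<zeta> t \<ge> 0" for t by (simp add: \<zeta>_def flat_fun_def)
  have zero: "\<zeta> t = 0" if "\<bar>t\<bar> \<ge> r" for t using that by (auto simp: \<zeta>_def flat_fun_def)
  have cont: "continuous_on {-r..r} \<zeta>" by (rule smooth_fun_continuous_on[OF sm])
  have "integral {-r..r} \<zeta> \<noteq> 0"
  proof
    assume "integral {-r..r} \<zeta> = 0"
    then have "\<zeta> 0 = 0"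
      using integral_eq_0_iff[OF cont _ nn] assms by auto
    then show False using assms by (simp add: \<zeta>_def flat_fun_def)
  qed
  moreover have "integral {-r..r} \<zeta> \<ge> 0"
    by (rule integral_nonneg) (use nn cont in \<open>auto intro: integrable_continuous_interval\<close>)
  ultimately have pos: "integral {-r..r} \<zeta> > 0" by simp
  show ?thesis
  proof
    show "smooth_fun (\<lambda>t. inverse (integral {-r..r} \<zeta>) * \<zeta> t)"
      using smooth_fun_affine[OF sm, of _ 1 0] by simp
  qed (use nn zero pos in auto)
qed

section \<open>Weak derivatives tested against functionals that annihilate polynomials\<close>

locale mollifier =
  fixes r :: real and \<eta> :: "real \<Rightarrow> real"
  assumes r_pos: "r > 0"
    and smooth: "smooth_fun \<eta>"
    and nonneg: "\<eta> t \<ge> 0"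
    and support: "\<bar>t\<bar> \<ge> r \<Longrightarrow> \<eta> t = 0"
    and mass: "integral {-r..r} \<eta> = 1"
begin

text \<open>
  The repeated primitives of the mollifier that vanish to the left of its support. Any base point to the left of \<open>- r\<close> gives the
  same functions; with one strictly to the left the fundamental theorem of calculus applies in a neighbourhood of \<open>- r\<close>.
\<close>

primrec J :: "nat \<Rightarrow> real \<Rightarrow> real" where
  "J 0 = \<eta>"
| "J (Suc k) = (\<lambda>s. integral {- (2 * r)..s} (J k))"

declare J.simps(2) [simp del]

lemma J_left: "s \<le> - r \<Longrightarrow> J k s = 0"
proof (induction k arbitrary: s)
  case 0
  then show ?case using r_pos by (simp add: support)
next
  case (Suc k)
  then have "integral {- (2 * r)..s} (J k) = integral {- (2 * r)..s} (\<lambda>_. 0)"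
    by (intro integral_cong) auto
  then show ?case by (simp add: J.simps(2))
qed

text \<open>
  Continuity of \<open>J k\<close> is itself a consequence of this lemma for \<open>k - 1\<close>, hence the separate hypothesis.
\<close>

lemma J_has_deriv_aux:
  assumes cont: "continuous_on UNIV (J k)"
  shows "(J (Suc k) has_real_derivative J k s) (at s)"
proof (cases "s < - r")
  case True
  show ?thesis
    by (rule has_field_derivative_transform_within_open[where f = "\<lambda>_. 0" and S = "{..<- r}"])
      (use True J_left in \<open>auto\<close>)
next
  case False
  with r_pos have s: "- (2 * r) < s" by simp
  have "((\<lambda>x. integral {- (2 * r)..x} (J k)) has_real_derivative J k s) (at s within {- (2 * r)..s + 1})"
    by (rule integral_has_real_derivative) (use s cont continuous_on_subset in auto)
  moreover have "at s within {- (2 * r)..s + 1} = at s"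
    by (rule at_within_Icc_at) (use s in auto)
  ultimately show ?thesis by (simp add: J.simps(2))
qed

lemma J_has_deriv: "(J (Suc k) has_real_derivative J k s) (at s)"
proof -
  have "continuous_on UNIV (J k)" for k
  proof (induction k)
    case 0
    then show ?case using smooth_fun_continuous_on[OF smooth] by simp
  next
    case (Suc k)
    show ?case
      using J_has_deriv_aux[OF Suc] DERIV_isCont continuous_at_imp_continuous_on by blast
  qed
  then show ?thesis by (rule J_has_deriv_aux)
qed

lemma smooth_J: "smooth_fun (J k)"
  by (induction k) (use smooth smooth_fun_antideriv[OF J_has_deriv] in \<open>simp_all\<close>)

lemma J_1_right: "s \<ge> r \<Longrightarrow> J 1 s = 1"
proof -
  assume s: "s \<ge> r"
  have "(\<eta> has_integral 1) {-r..r}"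
    using integrable_integral[OF integrable_continuous_interval[OF smooth_fun_continuous_on[OF smooth]], of "-r" r] mass
    by simp
  then have "(\<eta> has_integral 1) {- (2 * r)..s}"
    by (rule has_integral_on_superset) (use s r_pos in \<open>auto intro!: support\<close>)
  then show ?thesis by (simp add: integral_unique J.simps(2))
qed

lemma J_bound: "0 \<le> L \<Longrightarrow> s \<le> - r + L \<Longrightarrow> \<bar>J (Suc k) s\<bar> \<le> L ^ k"
proof (induction k arbitrary: s)
  case 0
  have mono: "J (Suc 0) x \<le> J (Suc 0) y" if "x \<le> y" for x y
    by (rule DERIV_nonneg_imp_nondecreasing[OF that])
      (use J_has_deriv[of 0] nonneg in auto)
  have "J (Suc 0) s \<le> 1"
    using mono[of s "max s r"] J_1_right[of "max s r"] by simp
  moreover have "J (Suc 0) s \<ge> 0"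
    using mono[of "min s (- r)" s] J_left[of "min s (- r)" "Suc 0"] by simp
  ultimately show ?case by simp
next
  case (Suc k)
  show ?case
  proof (cases "s \<le> - r")
    case True
    then show ?thesis using Suc.prems(1) by (simp add: J_left)
  next
    case False
    then obtain z where z: "- r < z" "z < s" "J (Suc (Suc k)) s - J (Suc (Suc k)) (- r) = (s - (- r)) * J (Suc k) z"
      using MVT2[of "- r" s "J (Suc (Suc k))" "J (Suc k)"] J_has_deriv by (auto)
    then have "\<bar>J (Suc (Suc k)) s\<bar> = (s + r) * \<bar>J (Suc k) z\<bar>"
      using False by (simp add: J_left abs_mult)
    also have "\<dots> \<le> L * L ^ k"
      using z Suc.prems False by (intro mult_mono Suc.IH) auto
    finally show ?thesis by simp
  qed
qed

text \<open>
  To the right of the support the derivative of order \<open>p\<close> of \<open>J p\<close> is zero, so \<open>J p\<close> coincides there with its Taylor polynomial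
  at \<open>r\<close>, which has degree less than \<open>p\<close>.
\<close>

lemma J_right:
  assumes "r \<le> s" "0 < p"
  shows "J p s = (\<Sum>k<p. J (p - k) r / fact k * (s - r) ^ k)"
proof (cases "r = s")
  case True
  then have "(\<Sum>k<p. J (p - k) r / fact k * (s - r) ^ k) = (\<Sum>k\<in>{0}. J (p - k) r / fact k * (s - r) ^ k)"
    using assms(2) by (intro sum.mono_neutral_right) auto
  with True show ?thesis by simp
next
  case False
  have "\<exists>t>r. t < s \<and> J p s = (\<Sum>m<p. J (p - m) r / fact m * (s - r) ^ m) + J (p - p) t / fact p * (s - r) ^ p"
  proof (rule Taylor_up[where a = r])
    show "\<forall>m t. m < p \<and> r \<le> t \<and> t \<le> s \<longrightarrow> (J (p - m) has_real_derivative J (p - Suc m) t) (at t)"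
      using J_has_deriv by (metis Suc_diff_Suc)
  qed (use assms False in auto)
  then show ?thesis by (auto simp: support)
qed

text \<open>
  The mollified Peano kernel. Each summand is a polynomial of degree less than \<open>p\<close> to the right of all nodes
  (lemma \<open>J_right\<close>), and the coefficients annihilate such polynomials in the node variable, so the sum has
  compact support although the individual primitives do not.
\<close>

lemma test_fun_combination:
  assumes I: "finite I" and p: "0 < p" and ab: "a \<le> \<alpha>" "\<beta> \<le> b"
    and y: "\<And>i. i \<in> I \<Longrightarrow> y i \<in> {\<alpha> + 2 * r..\<beta> - 2 * r}"
    and ann: "\<And>q::real poly. degree q < p \<Longrightarrow> (\<Sum>i\<in>I. c i * poly q (y i)) = 0"
    and \<phi>_def: "\<phi> = (\<lambda>s. \<Sum>i\<in>I. c i * J p (s - y i))"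
  shows "test_fun a b \<phi>"
    and "(deriv ^^ p) \<phi> = (\<lambda>s. \<Sum>i\<in>I. c i * \<eta> (s - y i))"
    and "s \<notin> {\<alpha> + r..\<beta> - r} \<Longrightarrow> \<phi> s = 0"
    and "\<bar>\<phi> s\<bar> \<le> (\<Sum>i\<in>I. \<bar>c i\<bar>) * (\<beta> - \<alpha>) ^ (p - 1)"
proof -
  have smooth_shift: "smooth_fun (\<lambda>s. \<Sum>i\<in>I. c i * J k (s - y i))" for k
    using smooth_fun_affine[OF smooth_J, where a = 1 and b = "- y i" for i]
    by (intro smooth_fun_sum I) simp
  have deriv: "(deriv ^^ k) \<phi> = (\<lambda>s. \<Sum>i\<in>I. c i * J (p - k) (s - y i))" if "k \<le> p" for k
    using that
  proof (induction k)
    case 0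
    then show ?case by (simp add: \<phi>_def)
  next
    case (Suc k)
    have "((\<lambda>s. \<Sum>i\<in>I. c i * J (p - k) (s - y i)) has_real_derivative
        (\<Sum>i\<in>I. c i * (J (p - Suc k) (s - y i) * 1))) (at s)" for s
    proof (intro DERIV_sum DERIV_cmult DERIV_chain2[where f = "J (p - k)"])
      show "(J (p - k) has_real_derivative J (p - Suc k) x) (at x)" for x
        using J_has_deriv[of "p - Suc k" x] Suc.prems by (simp add: Suc_diff_Suc)
      show "((\<lambda>s. s - y i) has_real_derivative 1) (at s)" for i
        by (auto intro!: derivative_eq_intros)
    qed
    then have "deriv (\<lambda>s. \<Sum>i\<in>I. c i * J (p - k) (s - y i)) = (\<lambda>s. \<Sum>i\<in>I. c i * J (p - Suc k) (s - y i))"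
      by (auto intro!: DERIV_imp_deriv)
    then show ?case using Suc by simp
  qed
  show "(deriv ^^ p) \<phi> = (\<lambda>s. \<Sum>i\<in>I. c i * \<eta> (s - y i))"
    using deriv[of p] by simp
  show zero: "\<phi> s = 0" if s: "s \<notin> {\<alpha> + r..\<beta> - r}" for s
  proof -
    consider "s < \<alpha> + r" | "s > \<beta> - r" using s by fastforce
    then show ?thesis
    proof cases
      case 1
      then have "J p (s - y i) = 0" if "i \<in> I" for i
        using y[OF that] by (intro J_left) auto
      then show ?thesis by (simp add: \<phi>_def)
    next
      case 2
      have "\<phi> s = (\<Sum>i\<in>I. c i * (\<Sum>k<p. J (p - k) r / fact k * (s - y i - r) ^ k))"
        unfolding \<phi>_def
      proof (intro sum.cong refl arg_cong2[where f = "(*)"] J_right)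
        show "r \<le> s - y i" if "i \<in> I" for i
          using y[OF that] 2 by auto
      qed (rule p)
      also have "\<dots> = (\<Sum>k<p. J (p - k) r / fact k * (\<Sum>i\<in>I. c i * (s - y i - r) ^ k))"
        unfolding sum_distrib_left by (subst sum.swap) (simp add: mult_ac)
      also have "\<dots> = 0"
      proof (intro sum.neutral ballI)
        fix k assume "k \<in> {..<p}"
        then have "degree ([:s - r, -1:] ^ k) < p"
          by (intro le_less_trans[OF degree_power_le]) auto
        from ann[OF this] have "(\<Sum>i\<in>I. c i * (s - y i - r) ^ k) = 0"
          by (simp add: poly_power algebra_simps)
        then show "J (p - k) r / fact k * (\<Sum>i\<in>I. c i * (s - y i - r) ^ k) = 0" by simp
      qed
      finally show ?thesis .
    qed
  qed
  show "test_fun a b \<phi>"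
    unfolding test_fun_def
  proof (intro conjI exI[of _ "{\<alpha> + r..\<beta> - r}"])
    show "\<forall>k t. (deriv ^^ k) \<phi> differentiable at t"
      using smooth_shift[of p] by (simp add: smooth_fun_def \<phi>_def)
  qed (use r_pos ab zero in auto)
  show "\<bar>\<phi> s\<bar> \<le> (\<Sum>i\<in>I. \<bar>c i\<bar>) * (\<beta> - \<alpha>) ^ (p - 1)"
  proof (cases "s \<in> {\<alpha> + r..\<beta> - r}")
    case True
    have "\<bar>\<phi> s\<bar> \<le> (\<Sum>i\<in>I. \<bar>c i\<bar> * (\<beta> - \<alpha>) ^ (p - 1))"
      unfolding \<phi>_def
    proof (rule order_trans[OF sum_abs sum_mono])
      fix i assume "i \<in> I"
      from y[OF this] have "\<bar>J (Suc (p - 1)) (s - y i)\<bar> \<le> (\<beta> - \<alpha>) ^ (p - 1)"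
        using True r_pos by (intro J_bound) auto
      then show "\<bar>c i * J p (s - y i)\<bar> \<le> \<bar>c i\<bar> * (\<beta> - \<alpha>) ^ (p - 1)"
        using p by (simp add: abs_mult mult_left_mono)
    qed
    then show ?thesis by (simp add: sum_distrib_right)
  next
    case False
    have "I = {} \<or> \<alpha> \<le> \<beta>" using y r_pos by fastforce
    then show ?thesis using zero[OF False] by (elim disjE) (auto intro!: mult_nonneg_nonneg sum_nonneg)
  qed
qed

text \<open>
  Shifting \<open>p\<close> derivatives from the mollified point masses to \<open>v\<close> costs only the supremum of the Peano kernel, and the
  kernel is supported in \<open>[\<alpha>, \<beta>]\<close>, so only the norm of \<open>v\<close> over this interval enters.
\<close>

lemma mollified_functional_bound:
  assumes I: "finite I" and p: "0 < p" and ab: "a \<le> \<alpha>" "\<beta> \<le> b" "\<alpha> \<le> \<beta>"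
    and y: "\<And>i. i \<in> I \<Longrightarrow> y i \<in> {\<alpha> + 2 * r..\<beta> - 2 * r}"
    and ann: "\<And>q::real poly. degree q < p \<Longrightarrow> (\<Sum>i\<in>I. c i * poly q (y i)) = 0"
    and g: "continuous_on {a..b} g" and wd: "has_weak_deriv a b p g v"
    and v: "v absolutely_integrable_on {a..b}"
  shows "\<bar>\<Sum>i\<in>I. c i * integral {a..b} (\<lambda>t. g t * \<eta> (t - y i))\<bar>
    \<le> (\<Sum>i\<in>I. \<bar>c i\<bar>) * (\<beta> - \<alpha>) ^ (p - 1) * integral {\<alpha>..\<beta>} (\<lambda>t. \<bar>v t\<bar>)"
proof -
  define \<phi> where "\<phi> = (\<lambda>s. \<Sum>i\<in>I. c i * J p (s - y i))"
  note \<phi> = test_fun_combination[where c = c, OF I p ab(1,2) y ann \<phi>_def]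
  let ?B = "(\<Sum>i\<in>I. \<bar>c i\<bar>) * (\<beta> - \<alpha>) ^ (p - 1)"
  have int: "(\<lambda>t. g t * \<eta> (t - y i)) integrable_on {a..b}" for i
    by (intro integrable_continuous_interval continuous_intros g
        continuous_on_compose2[OF smooth_fun_continuous_on[OF smooth, of UNIV]]) auto
  have "(\<Sum>i\<in>I. c i * integral {a..b} (\<lambda>t. g t * \<eta> (t - y i)))
      = integral {a..b} (\<lambda>t. \<Sum>i\<in>I. c i * (g t * \<eta> (t - y i)))"
    using int I by (subst integral_sum) (auto intro: integrable_on_mult_right)
  also have "\<dots> = integral {a<..<b} (\<lambda>t. g t * (deriv ^^ p) \<phi> t)"
    by (simp add: \<phi>(2) sum_distrib_left mult_ac integral_open_interval_real)
  also have "\<dots> = (- 1) ^ p * integral {a<..<b} (\<lambda>t. v t * \<phi> t)"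
    using wd \<phi>(1) by (simp add: has_weak_deriv_def)
  finally have "\<bar>\<Sum>i\<in>I. c i * integral {a..b} (\<lambda>t. g t * \<eta> (t - y i))\<bar>
      = \<bar>integral {a..b} (\<lambda>t. v t * \<phi> t)\<bar>"
    by (simp add: abs_mult power_abs integral_open_interval_real)
  also have "\<dots> \<le> ?B * integral {\<alpha>..\<beta>} (\<lambda>t. \<bar>v t\<bar>)"
  proof (cases "(\<lambda>t. v t * \<phi> t) integrable_on {a..b}")
    case True
    have sub: "{a..b} \<inter> {\<alpha>..\<beta>} = {\<alpha>..\<beta>}" "{\<alpha>..\<beta>} \<inter> {a..b} = {\<alpha>..\<beta>}" using ab by auto
    have v': "(\<lambda>t. \<bar>v t\<bar>) integrable_on {\<alpha>..\<beta>}"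
      using v ab by (auto simp: absolutely_integrable_on_def intro: integrable_on_subinterval)
    have bd: "\<bar>integral {a..b} (\<lambda>t. v t * \<phi> t)\<bar>
        \<le> integral {a..b} (\<lambda>t. if t \<in> {\<alpha>..\<beta>} then ?B * \<bar>v t\<bar> else 0)"
    proof (rule integral_norm_bound_integral[OF True, unfolded real_norm_def])
      show "(\<lambda>t. if t \<in> {\<alpha>..\<beta>} then ?B * \<bar>v t\<bar> else 0) integrable_on {a..b}"
        unfolding integrable_restrict_Int sub using v' by (intro integrable_on_mult_right)
      show "\<bar>v t * \<phi> t\<bar> \<le> (if t \<in> {\<alpha>..\<beta>} then ?B * \<bar>v t\<bar> else 0)" for t
        using \<phi>(3)[of t] mult_right_mono[OF \<phi>(4)[of t], of "\<bar>v t\<bar>"] r_pos by (auto simp: abs_mult mult_ac)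
    qed
    then show ?thesis unfolding integral_restrict_Int sub by simp
  next
    case False
    have "?B * integral {\<alpha>..\<beta>} (\<lambda>t. \<bar>v t\<bar>) \<ge> 0"
      using ab v by (intro mult_nonneg_nonneg sum_nonneg integral_nonneg zero_le_power)
        (auto simp: absolutely_integrable_on_def intro: integrable_on_subinterval)
    then show ?thesis using False by (simp add: not_integrable_integral)
  qed
  finally show ?thesis .
qed

lemma mollification_error:
  assumes g: "continuous_on {a..b} g" and y: "a \<le> y - r" "y + r \<le> b"
    and near: "\<And>t. t \<in> {a..b} \<Longrightarrow> \<bar>t - y\<bar> < r \<Longrightarrow> \<bar>g t - w\<bar> \<le> e"
  shows "\<bar>integral {a..b} (\<lambda>t. g t * \<eta> (t - y)) - w\<bar> \<le> e"
proof -
  have "((\<lambda>t. \<eta> (t - y)) has_integral (J 1 (b - y) - J 1 (a - y))) {a..b}"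
  proof (rule fundamental_theorem_of_calculus)
    show "((\<lambda>t. J 1 (t - y)) has_vector_derivative \<eta> (t - y)) (at t within {a..b})" for t
    proof -
      have "((\<lambda>t. J 1 (t - y)) has_real_derivative J 0 (t - y) * 1) (at t)"
        by (rule DERIV_chain2[where f = "J 1"]) (use J_has_deriv[of 0] in \<open>auto intro!: derivative_eq_intros simp: One_nat_def\<close>)
      then show ?thesis
        by (auto simp: has_real_derivative_iff_has_vector_derivative intro: has_vector_derivative_at_within)
    qed
  qed (use y r_pos in auto)
  then have \<eta>: "((\<lambda>t. \<eta> (t - y)) has_integral 1) {a..b}"
    using y r_pos J_1_right[of "b - y"] J_left[of "a - y" 1] by simp
  have "(\<lambda>t. g t * \<eta> (t - y)) integrable_on {a..b}"
    by (intro integrable_continuous_interval continuous_intros g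
        continuous_on_compose2[OF smooth_fun_continuous_on[OF smooth, of UNIV]]) auto
  from has_integral_diff[OF integrable_integral[OF this] has_integral_mult_right[OF \<eta>, of w]]
  have D: "((\<lambda>t. g t * \<eta> (t - y) - w * \<eta> (t - y)) has_integral
      (integral {a..b} (\<lambda>t. g t * \<eta> (t - y)) - w)) {a..b}" by simp
  have "norm (integral {a..b} (\<lambda>t. g t * \<eta> (t - y) - w * \<eta> (t - y))) \<le> integral {a..b} (\<lambda>t. e * \<eta> (t - y))"
  proof (rule integral_norm_bound_integral)
    fix t assume t: "t \<in> {a..b}"
    show "norm (g t * \<eta> (t - y) - w * \<eta> (t - y)) \<le> e * \<eta> (t - y)"
    proof (cases "\<bar>t - y\<bar> < r")
      case True
      then show ?thesis
        using mult_right_mono[OF near[OF t True] nonneg[of "t - y"]] nonneg[of "t - y"]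
        by (simp add: abs_mult flip: left_diff_distrib)
    qed (simp add: support)
  qed (use D \<eta> in \<open>auto intro: has_integral_integrable integrable_on_mult_right\<close>)
  also have "\<dots> = e" using \<eta> by (simp add: integral_unique)
  finally show ?thesis using D by (simp add: integral_unique)
qed

end

text \<open>
  The Peano kernel estimate for a function that is only weakly differentiable. The nodes may be end points of \<open>[a, b]\<close>,
  where no test function is supported, so they are first contracted towards the midpoint of \<open>[\<alpha>, \<beta>]\<close>;
  an affine change of the nodes preserves the annihilation of polynomials. The right-hand side does not depend on the
  contraction or on the width of the mollifier, and the left-hand side converges by uniform continuity of \<open>g\<close>.
\<close>

lemma annihilating_functional_bound:
  fixes g v :: "real \<Rightarrow> real" and c y :: "'i \<Rightarrow> real"
  assumes I: "finite I" and p: "0 < p" and ab: "a \<le> \<alpha>" "\<beta> \<le> b" "\<alpha> < \<beta>"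
    and y: "\<And>i. i \<in> I \<Longrightarrow> y i \<in> {\<alpha>..\<beta>}"
    and ann: "\<And>q::real poly. degree q < p \<Longrightarrow> (\<Sum>i\<in>I. c i * poly q (y i)) = 0"
    and g: "continuous_on {a..b} g" and wd: "has_weak_deriv a b p g v"
    and v: "v absolutely_integrable_on {a..b}"
  shows "\<bar>\<Sum>i\<in>I. c i * g (y i)\<bar>
    \<le> (\<Sum>i\<in>I. \<bar>c i\<bar>) * (\<beta> - \<alpha>) ^ (p - 1) * integral {\<alpha>..\<beta>} (\<lambda>t. \<bar>v t\<bar>)" (is "?l \<le> ?R")
proof (rule field_le_epsilon)
  fix e :: real assume "e > 0"
  define B where "B = (\<Sum>i\<in>I. \<bar>c i\<bar>)"
  have B: "B \<ge> 0" unfolding B_def by (intro sum_nonneg) auto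
  define e' where "e' = e / (B + 1)"
  have e': "e' > 0" using B \<open>e > 0\<close> by (simp add: e'_def)
  have "uniformly_continuous_on {a..b} g" by (rule compact_uniformly_continuous[OF g]) simp
  then obtain d where d: "d > 0" "\<And>s t. s \<in> {a..b} \<Longrightarrow> t \<in> {a..b} \<Longrightarrow> dist t s < d \<Longrightarrow> dist (g t) (g s) < e'"
    using e' unfolding uniformly_continuous_on_def by metis
  \<comment> \<open>The contraction moves nodes by at most \<open>2 r\<close> and the mollifier reaches \<open>r\<close> further; the total \<open>3 r\<close> must
    stay below the modulus of continuity \<open>d\<close>, and \<open>4 r \<le> \<beta> - \<alpha>\<close> leaves room for the contraction.\<close>
  define r where "r = min (d / 4) ((\<beta> - \<alpha>) / 4)"
  have r: "r > 0" "3 * r < d" "4 * r \<le> \<beta> - \<alpha>"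
    using d(1) ab by (auto simp: r_def min_def field_simps)
  \<comment> \<open>The contraction factor that frees a margin of exactly \<open>2 r\<close> at both ends of \<open>[\<alpha>, \<beta>]\<close>.\<close>
  define \<kappa> where "\<kappa> = 1 - 4 * r / (\<beta> - \<alpha>)"
  have \<kappa>: "0 \<le> \<kappa>" "(1 - \<kappa>) * (\<beta> - \<alpha>) = 4 * r" "\<kappa> \<le> 1" using r ab by (auto simp: \<kappa>_def field_simps)
  obtain \<eta> where \<eta>: "smooth_fun \<eta>" "\<And>t. \<eta> t \<ge> 0" "\<And>t. \<bar>t\<bar> \<ge> r \<Longrightarrow> \<eta> t = 0" "integral {-r..r} \<eta> = 1"
    using obtain_mollifier[OF r(1)] by blast
  interpret mollifier r \<eta> by unfold_locales (use r \<eta> in auto)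
  define m where "m = (\<alpha> + \<beta>) / 2"
  define z where "z i = m + \<kappa> * (y i - m)" for i
  have z1: "z i \<in> {\<alpha> + 2 * r..\<beta> - 2 * r}" and z2: "\<bar>z i - y i\<bar> \<le> 2 * r" if "i \<in> I" for i
  proof -
    have yi: "\<bar>y i - m\<bar> \<le> (\<beta> - \<alpha>) / 2" using y[OF that] by (auto simp: m_def abs_le_iff field_simps)
    have "\<bar>z i - m\<bar> \<le> \<kappa> * ((\<beta> - \<alpha>) / 2)"
      using mult_left_mono[OF yi \<kappa>(1)] \<kappa>(1) by (simp add: z_def abs_mult)
    also have "\<dots> = (\<beta> - \<alpha>) / 2 - 2 * r" using \<kappa>(2) by (simp add: field_simps)
    finally show "z i \<in> {\<alpha> + 2 * r..\<beta> - 2 * r}" by (auto simp: m_def abs_le_iff field_simps)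
    have "\<bar>z i - y i\<bar> = (1 - \<kappa>) * \<bar>y i - m\<bar>"
    proof -
      have "z i - y i = - ((1 - \<kappa>) * (y i - m))" by (simp add: z_def algebra_simps)
      then show ?thesis using \<kappa>(3) by (simp add: abs_mult)
    qed
    also have "\<dots> \<le> (1 - \<kappa>) * ((\<beta> - \<alpha>) / 2)" using yi \<kappa>(3) by (intro mult_left_mono) auto
    also have "\<dots> = 2 * r" using \<kappa>(2) by simp
    finally show "\<bar>z i - y i\<bar> \<le> 2 * r" .
  qed
  have annz: "(\<Sum>i\<in>I. c i * poly q (z i)) = 0" if "degree q < p" for q :: "real poly"
  proof -
    have "degree (pcompose q [:m - \<kappa> * m, \<kappa>:]) \<le> degree q * degree [:m - \<kappa> * m, \<kappa>:]"
      by (rule degree_pcompose_le)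
    also have "\<dots> \<le> degree q * 1" by (intro mult_left_mono) auto
    finally have "degree (pcompose q [:m - \<kappa> * m, \<kappa>:]) < p" using that by simp
    from ann[OF this] show ?thesis by (simp add: poly_pcompose z_def algebra_simps)
  qed
  define G where "G i = integral {a..b} (\<lambda>t. g t * \<eta> (t - z i))" for i
  have G: "\<bar>G i - g (y i)\<bar> \<le> e'" if "i \<in> I" for i
    unfolding G_def
  proof (rule mollification_error[OF g])
    show "a \<le> z i - r" "z i + r \<le> b" using z1[OF that] ab r by auto
    fix t assume t: "t \<in> {a..b}" "\<bar>t - z i\<bar> < r"
    then have "dist t (y i) < d" using z2[OF that] r by (simp add: dist_real_def)
    then show "\<bar>g t - g (y i)\<bar> \<le> e'"
      using d(2)[of "y i" t] y[OF that] ab t(1) by (simp add: dist_real_def)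
  qed
  have "?l \<le> \<bar>\<Sum>i\<in>I. c i * G i\<bar> + \<bar>\<Sum>i\<in>I. c i * (G i - g (y i))\<bar>"
    by (simp add: right_diff_distrib sum_subtractf)
  also have "\<bar>\<Sum>i\<in>I. c i * G i\<bar> \<le> ?R"
    unfolding G_def by (rule mollified_functional_bound[OF I p ab(1,2) less_imp_le[OF ab(3)] z1 annz g wd v])
  also have "\<bar>\<Sum>i\<in>I. c i * (G i - g (y i))\<bar> \<le> (\<Sum>i\<in>I. \<bar>c i\<bar> * e')"
    by (rule order_trans[OF sum_abs sum_mono]) (auto simp: abs_mult G mult_left_mono)
  also have "\<dots> = B * e'" by (simp add: B_def sum_distrib_right)
  also have "\<dots> \<le> e" using B \<open>e > 0\<close> by (simp add: e'_def field_simps)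
  finally show "?l \<le> ?R + e" by simp
qed

section \<open>Interpolation at equidistant nodes\<close>

definition lagrange_basis :: "nat \<Rightarrow> nat \<Rightarrow> real \<Rightarrow> real" where
  "lagrange_basis M j y = (\<Prod>i\<in>{0..M} - {j}. (y - real i) / (real j - real i))"

text \<open>
  Both sides are polynomials of degree at most \<open>M\<close> in \<open>y\<close> that agree at the \<open>M + 1\<close> nodes.
\<close>

lemma lagrange_interpolation_exact:
  fixes q :: "real poly"
  assumes "degree q \<le> M"
  shows "poly q y = (\<Sum>j\<le>M. poly q (real j) * lagrange_basis M j y)"
proof -
  define L :: "nat \<Rightarrow> real poly" where
    "L j = (\<Prod>i\<in>{0..M} - {j}. smult (inverse (real j - real i)) [:- real i, 1:])" for j
  have L: "poly (L j) y = lagrange_basis M j y" for j y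
    unfolding L_def lagrange_basis_def poly_prod by (simp add: divide_inverse algebra_simps)
  have deg: "degree (L j) \<le> M" if "j \<le> M" for j
  proof -
    have "degree (L j) \<le> (\<Sum>i\<in>{0..M} - {j}. degree (smult (inverse (real j - real i)) [:- real i, 1:]))"
      unfolding L_def by (rule order_trans[OF degree_prod_sum_le]) (simp_all add: o_def)
    also have "\<dots> \<le> (\<Sum>i\<in>{0..M} - {j}. 1)" by (intro sum_mono) simp
    also have "\<dots> = M" using that by simp
    finally show ?thesis .
  qed
  have "q = (\<Sum>j\<le>M. smult (poly q (real j)) (L j))"
  proof (rule poly_eqI_degree)
    fix x assume "x \<in> real ` {..M}"
    then obtain k where k: "x = real k" "k \<le> M" by auto
    have "lagrange_basis M j x = (if j = k then 1 else 0)" if "j \<le> M" for j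
    proof (cases "j = k")
      case True
      then show ?thesis by (simp add: lagrange_basis_def k(1))
    next
      case False
      then have "k \<in> {0..M} - {j}" using k(2) by simp
      then show ?thesis using False by (auto simp: lagrange_basis_def k(1) prod_zero_iff)
    qed
    then have "(\<Sum>j\<le>M. poly q (real j) * lagrange_basis M j x) = (\<Sum>j\<le>M. if j = k then poly q (real j) else 0)"
      by (intro sum.cong) auto
    also have "\<dots> = poly q x" using k by (simp add: sum.delta)
    finally show "poly q x = poly (\<Sum>j\<le>M. smult (poly q (real j)) (L j)) x"
      by (simp add: poly_sum L)
  next
    have "card (real ` {..M}) = Suc M" by (simp add: card_image)
    then show "degree q < card (real ` {..M})" "degree (\<Sum>j\<le>M. smult (poly q (real j)) (L j)) < card (real ` {..M})"
      using assms deg by (auto intro!: le_imp_less_Suc degree_sum_le order_trans[OF degree_smult_le])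
  qed
  then have "poly q y = poly (\<Sum>j\<le>M. smult (poly q (real j)) (L j)) y" by simp
  then show ?thesis by (simp add: poly_sum L)
qed

lemma lagrange_basis_bound:
  assumes "j \<le> M" "0 \<le> y" "y \<le> real M"
  shows "\<bar>lagrange_basis M j y\<bar> \<le> real M ^ M"
proof -
  have "\<bar>lagrange_basis M j y\<bar> = (\<Prod>i\<in>{0..M} - {j}. \<bar>(y - real i) / (real j - real i)\<bar>)"
    by (simp add: lagrange_basis_def abs_prod)
  also have "\<dots> \<le> (\<Prod>i\<in>{0..M} - {j}. real M)"
  proof (rule prod_mono, intro conjI)
    fix i assume i: "i \<in> {0..M} - {j}"
    then have "1 \<le> \<bar>real j - real i\<bar>" by auto
    moreover have "\<bar>y - real i\<bar> \<le> real M" using i assms by auto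
    ultimately show "\<bar>(y - real i) / (real j - real i)\<bar> \<le> real M"
      using frac_le[of "real M" "\<bar>y - real i\<bar>" 1 "\<bar>real j - real i\<bar>"] by (simp add: abs_divide)
  qed auto
  also have "\<dots> = real M ^ M" using assms(1) by simp
  finally show ?thesis .
qed

text \<open>
  The functional \<open>g \<mapsto> g(t) - \<Sum>\<^sub>j \<ell>\<^sub>j(y) g(a + j h)\<close> annihilates polynomials of degree at most \<open>M\<close>, where \<open>y = (t - a) / h\<close> is the position of \<open>t\<close> in
  units of the mesh size. It is encoded with index set \<open>{..M + 1}\<close>, the last index standing for the point \<open>t\<close>.
\<close>

lemma interpolation_error_weak:
  fixes g v :: "real \<Rightarrow> real"
  assumes M: "1 \<le> M" and h: "0 < h" and a: "0 \<le> a" "a + real M * h \<le> T"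
    and t: "t \<in> {a..a + real M * h}"
    and g: "continuous_on {0..T} g" and wd: "has_weak_deriv 0 T (M + 1) g v"
    and v: "v absolutely_integrable_on {0..T}"
  shows "\<bar>g t\<bar> \<le> real M ^ M * (\<Sum>j\<le>M. \<bar>g (a + real j * h)\<bar>)
    + (1 + real (M + 1) * real M ^ M) * (real M * h) ^ M * integral {a..a + real M * h} (\<lambda>t. \<bar>v t\<bar>)"
proof -
  define y where "y = (t - a) / h"
  have y: "0 \<le> y" "y \<le> real M" "t = a + y * h" using t h by (auto simp: y_def field_simps)
  define c where "c i = (if i \<le> M then - lagrange_basis M i y else 1)" for i
  define s where "s i = (if i \<le> M then a + real i * h else t)" for i
  have split: "(\<Sum>i\<le>Suc M. F i) = (\<Sum>i\<le>M. F i) + F (Suc M)" for F :: "nat \<Rightarrow> real" by simp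
  have "\<bar>\<Sum>i\<le>Suc M. c i * g (s i)\<bar>
    \<le> (\<Sum>i\<le>Suc M. \<bar>c i\<bar>) * ((a + real M * h) - a) ^ (M + 1 - 1) * integral {a..a + real M * h} (\<lambda>t. \<bar>v t\<bar>)"
  proof (rule annihilating_functional_bound[OF _ _ _ _ _ _ _ g wd v])
    show "s i \<in> {a..a + real M * h}" if "i \<in> {..Suc M}" for i
      using t h by (auto simp: s_def intro: mult_right_mono)
    show "(\<Sum>i\<le>Suc M. c i * poly q (s i)) = 0" if q: "degree q < M + 1" for q :: "real poly"
    proof -
      have "degree (pcompose q [:a, h:]) \<le> degree q * degree [:a, h:]" by (rule degree_pcompose_le)
      also have "\<dots> \<le> degree q * 1" by (intro mult_left_mono) auto
      finally have "degree (pcompose q [:a, h:]) \<le> M" using q by simp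
      from lagrange_interpolation_exact[OF this, of y]
      have "poly q t = (\<Sum>j\<le>M. poly q (a + real j * h) * lagrange_basis M j y)"
        by (simp add: poly_pcompose y(3) mult.commute)
      moreover have "(\<Sum>i\<le>M. c i * poly q (s i)) = - (\<Sum>j\<le>M. poly q (a + real j * h) * lagrange_basis M j y)"
        unfolding sum_negf[symmetric] by (intro sum.cong) (auto simp: c_def s_def)
      ultimately show ?thesis unfolding split by (simp add: c_def s_def)
    qed
  qed (use a h M in auto)
  moreover have "(\<Sum>i\<le>Suc M. c i * g (s i)) = g t - (\<Sum>j\<le>M. lagrange_basis M j y * g (a + real j * h))"
  proof -
    have "(\<Sum>i\<le>M. c i * g (s i)) = - (\<Sum>j\<le>M. lagrange_basis M j y * g (a + real j * h))"
      unfolding sum_negf[symmetric] by (intro sum.cong) (auto simp: c_def s_def)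
    then show ?thesis unfolding split by (simp add: c_def s_def)
  qed
  moreover have "(\<Sum>i\<le>Suc M. \<bar>c i\<bar>) \<le> 1 + real (M + 1) * real M ^ M"
  proof -
    have "(\<Sum>i\<le>M. \<bar>c i\<bar>) \<le> (\<Sum>i\<le>M. real M ^ M)"
      by (intro sum_mono) (auto simp: c_def lagrange_basis_bound y)
    then show ?thesis unfolding split by (simp add: c_def)
  qed
  then have "(\<Sum>i\<le>Suc M. \<bar>c i\<bar>) * (real M * h) ^ M * integral {a..a + real M * h} (\<lambda>t. \<bar>v t\<bar>)
      \<le> (1 + real (M + 1) * real M ^ M) * (real M * h) ^ M * integral {a..a + real M * h} (\<lambda>t. \<bar>v t\<bar>)"
    using h a v by (intro mult_right_mono integral_nonneg zero_le_power)
      (auto simp: absolutely_integrable_on_def intro: integrable_on_subinterval)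
  moreover have "\<bar>\<Sum>j\<le>M. lagrange_basis M j y * g (a + real j * h)\<bar> \<le> (\<Sum>j\<le>M. real M ^ M * \<bar>g (a + real j * h)\<bar>)"
    by (rule order_trans[OF sum_abs sum_mono])
      (auto simp: abs_mult intro!: mult_right_mono lagrange_basis_bound y)
  ultimately show ?thesis by (simp add: sum_distrib_left)
qed

lemma integral_grid_split:
  fixes \<phi> :: "real \<Rightarrow> real"
  assumes "0 \<le> h" "n0 \<le> n1" "n1 \<le> N" "\<phi> integrable_on {0..real N * h}"
  shows "integral {real n0 * h..real n1 * h} \<phi> = (\<Sum>k=n0..<n1. integral {real k * h..real (Suc k) * h} \<phi>)"
  using assms(2,3)
proof (induction n1 rule: dec_induct)
  case (step n)
  have le: "real n0 * h \<le> real n * h" "real n * h \<le> real (Suc n) * h" "real (Suc n) * h \<le> real N * h"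
    using step assms(1) by (auto intro!: mult_right_mono simp del: of_nat_Suc)
  moreover have "0 \<le> real n0 * h" using assms(1) by simp
  ultimately have "\<phi> integrable_on {real n0 * h..real (Suc n) * h}"
    by (intro integrable_on_subinterval[OF assms(4)]) auto
  from Henstock_Kurzweil_Integration.integral_combine[OF le(1,2) this]
  have "integral {real n0 * h..real n * h} \<phi> + integral {real n * h..real (Suc n) * h} \<phi>
      = integral {real n0 * h..real (Suc n) * h} \<phi>" .
  then show ?case using step by simp
qed simp

text \<open>
  Exchanging the summations, each index \<open>n\<close> occurs for at most \<open>2 M + 1\<close> values of \<open>k\<close>.
\<close>

lemma sum_banded_le:
  fixes V :: "nat \<Rightarrow> real"
  assumes "\<And>n. 0 \<le> V n" "n1 \<le> N"
  shows "(\<Sum>k=n0..<n1. \<Sum>n | n < N \<and> n \<le> k + M \<and> k \<le> n + M. V n) \<le> real (2 * M + 1) * (\<Sum>n<N. V n)"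
proof -
  have "(\<Sum>k=n0..<n1. \<Sum>n | n < N \<and> n \<le> k + M \<and> k \<le> n + M. V n)
      \<le> (\<Sum>k<N. \<Sum>n | n < N \<and> n \<le> k + M \<and> k \<le> n + M. V n)"
    using assms by (intro sum_mono2 sum_nonneg) auto
  also have "\<dots> = (\<Sum>n<N. \<Sum>k | k < N \<and> n \<le> k + M \<and> k \<le> n + M. V n)"
    using sum.swap_restrict[of "{..<N}" "{..<N}" "\<lambda>k n. V n" "\<lambda>k n. n \<le> k + M \<and> k \<le> n + M"]
    by simp
  also have "\<dots> \<le> (\<Sum>n<N. real (2 * M + 1) * V n)"
  proof (intro sum_mono)
    fix n
    have "card {k. k < N \<and> n \<le> k + M \<and> k \<le> n + M} \<le> card {n - M..n + M}"
      by (intro card_mono) auto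
    also have "\<dots> \<le> 2 * M + 1" by simp
    finally have "real (card {k. k < N \<and> n \<le> k + M \<and> k \<le> n + M}) \<le> real (2 * M + 1)"
      by (simp only: of_nat_le_iff)
    then show "(\<Sum>k | k < N \<and> n \<le> k + M \<and> k \<le> n + M. V n) \<le> real (2 * M + 1) * V n"
      using assms(1)[of n] by (simp add: mult_right_mono)
  qed
  finally show ?thesis by (simp add: sum_distrib_left)
qed

text \<open>
  Each cell is covered by a block of \<open>M\<close> cells on which the interpolation estimate applies. Blocks of different cells overlap,
  but only boundedly often, so the local norms of \<open>v\<close> add up to a multiple of the global one. Moving the index by at
  most \<open>M\<close> within a block changes the geometric weights by a factor of at most \<open>\<theta>\<^sup>-\<^sup>M\<close>.
\<close>

lemma integral_bound_from_nodes:
  fixes g v :: "real \<Rightarrow> real" and \<theta> :: real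
  assumes M: "1 \<le> M" "M \<le> N" and h: "0 < h" and \<theta>: "0 < \<theta>" "\<theta> < 1"
    and nn: "0 \<le> K" "0 \<le> \<tau>" "0 \<le> a" "0 \<le> b"
    and g: "continuous_on {0..real N * h} g" and wd: "has_weak_deriv 0 (real N * h) (M + 1) g v"
    and v: "v absolutely_integrable_on {0..real N * h}"
    and nodes: "\<And>j. j \<le> N \<Longrightarrow> \<bar>g (real j * h)\<bar> \<le> K * (\<tau> + \<theta> ^ j * a + \<theta> ^ (N - j) * b)"
    and n: "n0 \<le> n1" "n1 \<le> N"
  shows "integral {real n0 * h..real n1 * h} (\<lambda>t. \<bar>g t\<bar>)
    \<le> real M ^ M * real (M + 1) * K * (1 / \<theta>) ^ M * (h * (\<Sum>k=n0..<n1. \<tau> + \<theta> ^ k * a + \<theta> ^ (N - k) * b))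
      + (1 + real (M + 1) * real M ^ M) * real M ^ M * real (2 * M + 1) * h ^ (M + 1)
        * integral {0..real N * h} (\<lambda>t. \<bar>v t\<bar>)"
proof -
  let ?C1 = "real M ^ M * real (M + 1) * K * (1 / \<theta>) ^ M"
  let ?C2 = "(1 + real (M + 1) * real M ^ M) * real M ^ M"
  define V where "V n = integral {real n * h..real (Suc n) * h} (\<lambda>t. \<bar>v t\<bar>)" for n
  define V' where "V' n = (if n < N then V n else 0)" for n
  let ?near = "\<lambda>k. {n. n < N \<and> n \<le> k + M \<and> k \<le> n + M}"
  have vi: "(\<lambda>t. \<bar>v t\<bar>) integrable_on {0..real N * h}"
    using v by (simp add: absolutely_integrable_on_def)
  have gi: "(\<lambda>t. \<bar>g t\<bar>) integrable_on {0..real N * h}"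
    by (intro integrable_continuous_interval continuous_intros g)
  have sub: "{real i * h..real j * h} \<subseteq> {0..real N * h}" if "j \<le> N" for i j
    using h that by (auto intro: order_trans mult_right_mono intro!: order_trans[OF mult_nonneg_nonneg])
  have V'_nn: "0 \<le> V' n" for n
    using integrable_on_subinterval[OF vi sub[of "Suc n" n]]
    by (auto simp: V'_def V_def intro!: integral_nonneg)
  have cell: "integral {real k * h..real (Suc k) * h} (\<lambda>t. \<bar>g t\<bar>)
      \<le> ?C1 * (h * (\<tau> + \<theta> ^ k * a + \<theta> ^ (N - k) * b)) + ?C2 * h ^ (M + 1) * (\<Sum>n\<in>?near k. V' n)"
    if k: "k < N" for k
  proof -
    \<comment> \<open>The block starts at the cell itself, except near the right end, where it is pushed back to stay inside the grid.\<close>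
    define s where "s = min k (N - M)"
    have s: "s \<le> k" "Suc k \<le> s + M" "s + M \<le> N" using k M by (auto simp: s_def)
    define B where "B = real M ^ M * (\<Sum>j\<le>M. \<bar>g (real s * h + real j * h)\<bar>)
      + (1 + real (M + 1) * real M ^ M) * (real M * h) ^ M * integral {real s * h..real s * h + real M * h} (\<lambda>t. \<bar>v t\<bar>)"
    have block: "real s * h + real M * h = real (s + M) * h" by (simp add: algebra_simps)
    have "\<bar>g t\<bar> \<le> B" if t: "t \<in> {real k * h..real (Suc k) * h}" for t
      unfolding B_def
    proof (rule interpolation_error_weak[OF M(1) h _ _ _ g wd v])
      show "0 \<le> real s * h" using h by simp
      show "real s * h + real M * h \<le> real N * h" unfolding block using h s by (intro mult_right_mono) auto
      have "real s * h \<le> real k * h" "real (Suc k) * h \<le> real (s + M) * h"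
        using h s by (auto intro!: mult_right_mono simp del: of_nat_Suc of_nat_add)
      then show "t \<in> {real s * h..real s * h + real M * h}" unfolding block using t by auto
    qed
    then have "integral {real k * h..real (Suc k) * h} (\<lambda>t. \<bar>g t\<bar>) \<le> integral {real k * h..real (Suc k) * h} (\<lambda>t. B)"
      using integrable_on_subinterval[OF gi sub[of "Suc k" k]] k by (intro integral_le) auto
    also have "\<dots> = h * B" using h by (simp add: algebra_simps)
    also have "B \<le> ?C1 * (\<tau> + \<theta> ^ k * a + \<theta> ^ (N - k) * b) + ?C2 * h ^ M * (\<Sum>n\<in>?near k. V' n)"
      unfolding B_def
    proof (rule add_mono)
      have "\<bar>g (real s * h + real j * h)\<bar> \<le> K * ((1 / \<theta>) ^ M * (\<tau> + \<theta> ^ k * a + \<theta> ^ (N - k) * b))" if "j \<le> M" for j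
      proof -
        have pw: "\<theta> ^ i \<le> (1 / \<theta>) ^ M * \<theta> ^ l" if "l \<le> i + M" for i l
        proof -
          have "\<theta> ^ i * \<theta> ^ M \<le> \<theta> ^ l"
            using that \<theta> by (simp add: power_decreasing flip: power_add)
          then show ?thesis using \<theta> by (simp add: power_one_over field_simps)
        qed
        have one: "1 \<le> (1 / \<theta>) ^ M" using \<theta> by (intro one_le_power) auto
        have "\<bar>g (real (s + j) * h)\<bar> \<le> K * (\<tau> + \<theta> ^ (s + j) * a + \<theta> ^ (N - (s + j)) * b)"
          using that s by (intro nodes) auto
        also have "\<dots> \<le> K * ((1 / \<theta>) ^ M * \<tau> + ((1 / \<theta>) ^ M * \<theta> ^ k) * a + ((1 / \<theta>) ^ M * \<theta> ^ (N - k)) * b)"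
          using nn one that s mult_right_mono[OF one nn(2)]
          by (intro mult_left_mono add_mono mult_right_mono pw) auto
        finally show ?thesis by (simp add: algebra_simps)
      qed
      then have "(\<Sum>j\<le>M. \<bar>g (real s * h + real j * h)\<bar>) \<le> (\<Sum>j\<le>M. K * ((1 / \<theta>) ^ M * (\<tau> + \<theta> ^ k * a + \<theta> ^ (N - k) * b)))"
        by (intro sum_mono) auto
      then have "real M ^ M * (\<Sum>j\<le>M. \<bar>g (real s * h + real j * h)\<bar>)
          \<le> real M ^ M * (\<Sum>j\<le>M. K * ((1 / \<theta>) ^ M * (\<tau> + \<theta> ^ k * a + \<theta> ^ (N - k) * b)))"
        by (rule mult_left_mono) simp
      then show "real M ^ M * (\<Sum>j\<le>M. \<bar>g (real s * h + real j * h)\<bar>) \<le> ?C1 * (\<tau> + \<theta> ^ k * a + \<theta> ^ (N - k) * b)"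
        by (simp add: mult.assoc)
      have "integral {real s * h..real (s + M) * h} (\<lambda>t. \<bar>v t\<bar>) = (\<Sum>n=s..<s+M. V n)"
        unfolding V_def using h s vi by (intro integral_grid_split) auto
      also have "\<dots> = (\<Sum>n=s..<s+M. V' n)" using s by (intro sum.cong) (auto simp: V'_def)
      also have "\<dots> \<le> (\<Sum>n\<in>?near k. V' n)"
        using s V'_nn by (intro sum_mono2) auto
      finally show "(1 + real (M + 1) * real M ^ M) * (real M * h) ^ M * integral {real s * h..real s * h + real M * h} (\<lambda>t. \<bar>v t\<bar>)
          \<le> ?C2 * h ^ M * (\<Sum>n\<in>?near k. V' n)"
        unfolding block power_mult_distrib mult.assoc[symmetric] using h by (intro mult_left_mono) auto
    qed
    finally show ?thesis using h by (simp add: algebra_simps)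
  qed
  have "integral {real n0 * h..real n1 * h} (\<lambda>t. \<bar>g t\<bar>)
      = (\<Sum>k=n0..<n1. integral {real k * h..real (Suc k) * h} (\<lambda>t. \<bar>g t\<bar>))"
    using h n gi by (intro integral_grid_split) auto
  also have "\<dots> \<le> (\<Sum>k=n0..<n1. ?C1 * (h * (\<tau> + \<theta> ^ k * a + \<theta> ^ (N - k) * b)) + ?C2 * h ^ (M + 1) * (\<Sum>n\<in>?near k. V' n))"
    using n by (intro sum_mono cell) auto
  also have "\<dots> = ?C1 * (h * (\<Sum>k=n0..<n1. \<tau> + \<theta> ^ k * a + \<theta> ^ (N - k) * b))
      + ?C2 * h ^ (M + 1) * (\<Sum>k=n0..<n1. \<Sum>n\<in>?near k. V' n)"
  proof -
    have "(\<Sum>k=n0..<n1. c * (h * X k) + d * Y k) = c * (h * (\<Sum>k=n0..<n1. X k)) + d * (\<Sum>k=n0..<n1. Y k)"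
      for c d :: real and X Y :: "nat \<Rightarrow> real"
      by (simp only: sum.distrib sum_distrib_left)
    then show ?thesis .
  qed
  also have "\<dots> \<le> ?C1 * (h * (\<Sum>k=n0..<n1. \<tau> + \<theta> ^ k * a + \<theta> ^ (N - k) * b))
      + ?C2 * h ^ (M + 1) * (real (2 * M + 1) * (\<Sum>n<N. V' n))"
    using h by (intro add_left_mono mult_left_mono sum_banded_le[OF V'_nn n(2)]) auto
  also have "(\<Sum>n<N. V' n) = integral {0..real N * h} (\<lambda>t. \<bar>v t\<bar>)"
    using integral_grid_split[of h 0 N N "\<lambda>t. \<bar>v t\<bar>"] h vi
    by (simp add: V'_def V_def atLeast0LessThan)
  finally show ?thesis by (simp only: mult_ac)
qed

section \<open>Order of the Adams--Moulton scheme\<close>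

lemma prod_differences_fact:
  assumes "m \<le> M"
  shows "(\<Prod>k\<in>{0..M} - {m}. real k - real m) = (- 1) ^ m * fact m * fact (M - m)"
proof -
  have *: "{0..M} - {m} = {0..<m} \<union> {Suc m..M}" using assms by auto
  have "(\<Prod>k\<in>{0..M} - {m}. real k - real m)
      = (\<Prod>k\<in>{0..<m}. real k - real m) * (\<Prod>k\<in>{Suc m..M}. real k - real m)"
    unfolding * by (rule prod.union_disjoint) auto
  also have "(\<Prod>k\<in>{0..<m}. real k - real m) = (\<Prod>k\<in>{0..<m}. - 1 * real (m - k))"
    by (intro prod.cong) auto
  also have "\<dots> = (- 1) ^ m * fact m"
    by (simp only: prod.distrib fact_prod_rev of_nat_prod) simp
  also have "(\<Prod>k\<in>{Suc m..M}. real k - real m) = (\<Prod>k\<in>{1..M - m}. real k)"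
    by (rule prod.reindex_bij_witness[of _ "\<lambda>k. k + m" "\<lambda>k. k - m"]) (use assms in auto)
  also have "\<dots> = fact (M - m)" by (simp add: fact_prod)
  finally show ?thesis .
qed

text \<open>
  The coefficients are the weights of interpolatory quadrature: the step runs over \<open>[M - 1, M]\<close> in the coordinate in
  which the nodes are \<open>0, \<dots>, M\<close>, and the node of index \<open>M - m\<close> carries the value \<open>f\<^sub>n\<^sub>-\<^sub>m\<close>.
\<close>

lemma AM_beta_eq_integral_lagrange:
  assumes "m \<le> M"
  shows "AM_beta M m = integral {0..1} (\<lambda>u. lagrange_basis M (M - m) (u + real M - 1))"
proof -
  have "lagrange_basis M (M - m) (u + real M - 1)
      = (- 1) ^ m / (fact m * fact (M - m)) * (\<Prod>i\<in>{0..M} - {m}. u + real i - 1)" for u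
  proof -
    have "lagrange_basis M (M - m) (u + real M - 1)
        = (\<Prod>k\<in>{0..M} - {m}. (u + real k - 1) / (real k - real m))"
      unfolding lagrange_basis_def
      by (rule prod.reindex_bij_witness[of _ "\<lambda>k. M - k" "\<lambda>k. M - k"]) (use assms in \<open>auto simp: of_nat_diff algebra_simps\<close>)
    also have "\<dots> = (\<Prod>i\<in>{0..M} - {m}. u + real i - 1) / ((- 1) ^ m * fact m * fact (M - m))"
      using prod_differences_fact[OF assms] by (simp add: prod_dividef)
    also have "\<dots> = (- 1) ^ m / (fact m * fact (M - m)) * (\<Prod>i\<in>{0..M} - {m}. u + real i - 1)"
      by (cases "even m") (auto simp: field_simps)
    finally show ?thesis .
  qed
  then show ?thesis by (simp add: AM_beta_def)
qed

lemma continuous_on_lagrange_basis: "continuous_on S (lagrange_basis M j)"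
  unfolding lagrange_basis_def[abs_def] divide_inverse by (intro continuous_intros)

lemma integral_shifted_power:
  fixes c :: real
  shows "integral {0..1} (\<lambda>u. (u + c) ^ k) = ((1 + c) ^ Suc k - c ^ Suc k) / real (Suc k)"
proof -
  have "((\<lambda>u. (u + c) ^ k) has_integral
      ((1 + c) ^ Suc k / real (Suc k) - (0 + c) ^ Suc k / real (Suc k))) {0..1}"
  proof (rule fundamental_theorem_of_calculus)
    fix u :: real
    have "((\<lambda>u. (u + c) ^ Suc k / real (Suc k)) has_real_derivative (u + c) ^ k) (at u within {0..1})"
      by (auto intro!: derivative_eq_intros simp del: power_Suc of_nat_Suc)
    then show "((\<lambda>u. (u + c) ^ Suc k / real (Suc k)) has_vector_derivative (u + c) ^ k) (at u within {0..1})"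
      by (simp add: has_real_derivative_iff_has_vector_derivative)
  qed simp
  from integral_unique[OF this] show ?thesis by (simp add: diff_divide_distrib)
qed

text \<open>
  The left-hand side is the integral over the last cell \<open>[M - 1, M]\<close> of the interpolant of the monomial of degree \<open>k\<close>, and
  for \<open>k \<le> M\<close> this interpolant is the monomial itself.
\<close>

lemma AM_exact:
  assumes "k \<le> M"
  shows "(\<Sum>m=0..M. AM_beta M m * real (M - m) ^ k) = (real M ^ Suc k - (real M - 1) ^ Suc k) / real (Suc k)"
proof -
  have int: "(\<lambda>u. lagrange_basis M j (u + real M - 1)) integrable_on {0..1}" for j
    by (intro integrable_continuous_interval continuous_on_compose2[OF continuous_on_lagrange_basis[of UNIV]] continuous_intros) auto
  have "(\<Sum>m=0..M. AM_beta M m * real (M - m) ^ k)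
      = (\<Sum>j\<le>M. integral {0..1} (\<lambda>u. lagrange_basis M j (u + real M - 1)) * real j ^ k)"
    by (rule sum.reindex_bij_witness[of _ "\<lambda>j. M - j" "\<lambda>j. M - j"]) (auto simp: AM_beta_eq_integral_lagrange)
  also have "\<dots> = integral {0..1} (\<lambda>u. \<Sum>j\<le>M. real j ^ k * lagrange_basis M j (u + real M - 1))"
    using int by (subst integral_sum) (auto intro: integrable_on_mult_right simp: mult.commute)
  also have "\<dots> = integral {0..1} (\<lambda>u. (u + real M - 1) ^ k)"
    using lagrange_interpolation_exact[of "monom 1 k" M, symmetric] assms
    by (simp add: poly_monom degree_monom_eq)
  also have "\<dots> = (real M ^ Suc k - (real M - 1) ^ Suc k) / real (Suc k)"
    using integral_shifted_power[of "real M - 1" k] by (simp add: add_diff_eq)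
  finally show ?thesis .
qed

text \<open>
  On \<open>[0, 1]\<close> each of the \<open>M\<close> factors \<open>u + i - 1\<close> with \<open>i \<ge> 1\<close> is at least \<open>u\<close>.
\<close>

lemma AM_beta_0_pos: "AM_beta M 0 > 0"
proof -
  have "integral {0..1} (\<lambda>u::real. u ^ M) \<le> integral {0..1} (\<lambda>u. \<Prod>i\<in>{0..M} - {0}. u + real i - 1)"
  proof (rule integral_le)
    fix u :: real assume u: "u \<in> {0..1}"
    have "(\<Prod>i\<in>{0..M} - {0}. u) \<le> (\<Prod>i\<in>{0..M} - {0}. u + real i - 1)"
      by (intro prod_mono) (use u in auto)
    then show "u ^ M \<le> (\<Prod>i\<in>{0..M} - {0}. u + real i - 1)" by simp
  qed (intro integrable_continuous_interval continuous_intros)+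
  moreover have "integral {0..1} (\<lambda>u::real. u ^ M) = 1 / real (Suc M)"
    using integral_shifted_power[of 0 M] by simp
  moreover have "0 < 1 / real (Suc M)" by simp
  ultimately have "integral {0..1} (\<lambda>u. \<Prod>i\<in>{0..M} - {0}. u + real i - 1) > 0"
    by linarith
  then show ?thesis by (simp add: AM_beta_def)
qed

lemma Taylor_remainder_bound:
  fixes d :: "nat \<Rightarrow> real \<Rightarrow> real"
  assumes d: "\<And>j t. j < n \<Longrightarrow> t \<in> {a..b} \<Longrightarrow> (d j has_real_derivative d (Suc j) t) (at t within {a..b})"
    and K: "\<And>t. t \<in> {a..b} \<Longrightarrow> \<bar>d n t\<bar> \<le> K" and n: "0 < n" and ab: "a \<le> b"
  shows "\<bar>d 0 b - (\<Sum>k<n. (b - a) ^ k / fact k * d k a)\<bar> \<le> K * (b - a) ^ n"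
proof -
  obtain m where m: "n = Suc m" using n by (cases n) auto
  have "norm (d 0 b - (\<Sum>i\<le>m. d i a * (b - a) ^ i / fact i)) \<le> K * norm (b - a) ^ Suc m / fact m"
    by (rule field_Taylor[where S = "{a..b}"]) (use d K ab in \<open>auto simp: m\<close>)
  also have "\<dots> \<le> K * norm (b - a) ^ Suc m"
    using frac_le[of "K * norm (b - a) ^ Suc m" _ 1 "fact m"] K[of a] ab fact_ge_1[of m]
    by (simp add: abs_le_iff)
  finally show ?thesis using ab by (simp add: m lessThan_Suc_atMost mult.commute)
qed

text \<open>
  Here \<open>d 0\<close> is the solution component and \<open>d 1\<close> the right-hand side along it. Both are expanded at the leftmost
  node of the stencil: the Taylor polynomials cancel because of \<open>AM_exact\<close>, and only the remainders \<open>R\<close> and \<open>Q\<close> are left.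
\<close>

lemma AM_truncation_error:
  fixes d :: "nat \<Rightarrow> real \<Rightarrow> real"
  assumes M: "1 \<le> M" and h: "0 < h" and a: "0 \<le> a" "a + real M * h \<le> T"
    and d: "\<And>j t. j < M + 2 \<Longrightarrow> t \<in> {0..T} \<Longrightarrow> (d j has_real_derivative d (Suc j) t) (at t within {0..T})"
    and K: "\<And>t. t \<in> {0..T} \<Longrightarrow> \<bar>d (M + 2) t\<bar> \<le> K"
  shows "\<bar>(d 0 (a + real M * h) - d 0 (a + (real M - 1) * h)) / h
          - (\<Sum>m=0..M. AM_beta M m * d 1 (a + real (M - m) * h))\<bar>
      \<le> K * (2 * real M ^ (M + 2) + (\<Sum>m=0..M. \<bar>AM_beta M m\<bar>) * real M ^ (M + 1)) * h ^ (M + 1)"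
proof -
  have K0: "K \<ge> 0" using K[of a] a h by (smt (verit) abs_ge_zero atLeastAtMost_iff mult_nonneg_nonneg of_nat_0_le_iff)
  define R where "R y = d 0 (a + y * h) - (\<Sum>k<M+2. (y * h) ^ k / fact k * d k a)" for y
  define Q where "Q y = d 1 (a + y * h) - (\<Sum>k<M+1. (y * h) ^ k / fact k * d (Suc k) a)" for y
  have sub: "{a..a + y * h} \<subseteq> {0..T}" if "0 \<le> y" "y \<le> real M" for y
  proof -
    have "y * h \<le> real M * h" using that h by (intro mult_right_mono) auto
    then show ?thesis using a by auto
  qed
  have R: "\<bar>R y\<bar> \<le> K * (real M * h) ^ (M + 2)" if y: "0 \<le> y" "y \<le> real M" for y
  proof -
    have "\<bar>d 0 (a + y * h) - (\<Sum>k<M+2. ((a + y * h) - a) ^ k / fact k * d k a)\<bar> \<le> K * ((a + y * h) - a) ^ (M + 2)"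
      using sub[OF y] y h by (intro Taylor_remainder_bound K DERIV_subset[OF d]) auto
    then have "\<bar>R y\<bar> \<le> K * (y * h) ^ (M + 2)" by (simp add: R_def)
    also have "\<dots> \<le> K * (real M * h) ^ (M + 2)"
      using y h K0 by (intro mult_left_mono power_mono mult_right_mono) auto
    finally show ?thesis .
  qed
  have Q: "\<bar>Q y\<bar> \<le> K * (real M * h) ^ (M + 1)" if y: "0 \<le> y" "y \<le> real M" for y
  proof -
    have "\<bar>(\<lambda>j. d (Suc j)) 0 (a + y * h) - (\<Sum>k<M+1. ((a + y * h) - a) ^ k / fact k * (\<lambda>j. d (Suc j)) k a)\<bar>
        \<le> K * ((a + y * h) - a) ^ (M + 1)"
      using sub[OF y] y h K by (intro Taylor_remainder_bound DERIV_subset[OF d]) auto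
    then have "\<bar>Q y\<bar> \<le> K * (y * h) ^ (M + 1)" by (simp add: Q_def)
    also have "\<dots> \<le> K * (real M * h) ^ (M + 1)"
      using y h K0 by (intro mult_left_mono power_mono mult_right_mono) auto
    finally show ?thesis .
  qed
  have X: "(d 0 (a + y * h) - d 0 (a + z * h)) / h
      = (\<Sum>k<M+1. h ^ k * d (Suc k) a * ((y ^ Suc k - z ^ Suc k) / fact (Suc k))) + (R y - R z) / h" for y z
  proof -
    have "(\<Sum>k<M+2. (y * h) ^ k / fact k * d k a) - (\<Sum>k<M+2. (z * h) ^ k / fact k * d k a)
        = (\<Sum>k<Suc (M+1). ((y * h) ^ k - (z * h) ^ k) / fact k * d k a)"
      unfolding sum_subtractf[symmetric]
      by (intro sum.cong) (auto simp: diff_divide_distrib left_diff_distrib)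
    also have "\<dots> = (\<Sum>k<M+1. ((y * h) ^ Suc k - (z * h) ^ Suc k) / fact (Suc k) * d (Suc k) a)"
      by (subst sum.lessThan_Suc_shift) simp
    also have "\<dots> = h * (\<Sum>k<M+1. h ^ k * d (Suc k) a * ((y ^ Suc k - z ^ Suc k) / fact (Suc k)))"
      unfolding sum_distrib_left
      by (intro sum.cong refl) (simp add: power_mult_distrib field_simps del: fact_Suc)
    finally show ?thesis using h by (simp add: R_def field_simps)
  qed
  have Y: "(\<Sum>m=0..M. AM_beta M m * d 1 (a + real (M - m) * h))
      = (\<Sum>k<M+1. h ^ k * d (Suc k) a * ((real M ^ Suc k - (real M - 1) ^ Suc k) / fact (Suc k)))
        + (\<Sum>m=0..M. AM_beta M m * Q (real (M - m)))"
  proof -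
    have "(\<Sum>m=0..M. AM_beta M m * (\<Sum>k<M+1. (real (M - m) * h) ^ k / fact k * d (Suc k) a))
      = (\<Sum>k<M+1. h ^ k * d (Suc k) a / fact k * (\<Sum>m=0..M. AM_beta M m * real (M - m) ^ k))"
      unfolding sum_distrib_left by (subst sum.swap) (simp add: power_mult_distrib mult_ac)
    also have "\<dots> = (\<Sum>k<M+1. h ^ k * d (Suc k) a * ((real M ^ Suc k - (real M - 1) ^ Suc k) / fact (Suc k)))"
    proof (rule sum.cong[OF refl])
      fix k assume "k \<in> {..<M+1}"
      then have "(\<Sum>m=0..M. AM_beta M m * real (M - m) ^ k) = (real M ^ Suc k - (real M - 1) ^ Suc k) / real (Suc k)"
        by (intro AM_exact) auto
      then show "h ^ k * d (Suc k) a / fact k * (\<Sum>m=0..M. AM_beta M m * real (M - m) ^ k)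
        = h ^ k * d (Suc k) a * ((real M ^ Suc k - (real M - 1) ^ Suc k) / fact (Suc k))"
        by (simp only:) (simp add: fact_Suc mult_ac del: of_nat_Suc power_Suc)
    qed
    finally show ?thesis
      unfolding Q_def right_diff_distrib sum_subtractf by simp
  qed
  have "(d 0 (a + real M * h) - d 0 (a + (real M - 1) * h)) / h
          - (\<Sum>m=0..M. AM_beta M m * d 1 (a + real (M - m) * h))
      = (R (real M) - R (real M - 1)) / h - (\<Sum>m=0..M. AM_beta M m * Q (real (M - m)))"
    unfolding X Y by simp
  also have "\<bar>\<dots>\<bar> \<le> (2 * (K * (real M * h) ^ (M + 2))) / h + (\<Sum>m=0..M. \<bar>AM_beta M m\<bar> * (K * (real M * h) ^ (M + 1)))"
  proof (rule order_trans[OF abs_triangle_ineq4 add_mono])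
    show "\<bar>(R (real M) - R (real M - 1)) / h\<bar> \<le> (2 * (K * (real M * h) ^ (M + 2))) / h"
    proof -
      have "\<bar>R (real M)\<bar> \<le> K * (real M * h) ^ (M + 2)" "\<bar>R (real M - 1)\<bar> \<le> K * (real M * h) ^ (M + 2)"
        using R[of "real M"] R[of "real M - 1"] M by auto
      then have "\<bar>R (real M) - R (real M - 1)\<bar> \<le> 2 * (K * (real M * h) ^ (M + 2))" by linarith
      then have "\<bar>R (real M) - R (real M - 1)\<bar> / h \<le> (2 * (K * (real M * h) ^ (M + 2))) / h"
        using h by (intro divide_right_mono) auto
      then show ?thesis using h by (simp only: abs_divide abs_of_pos)
    qed
    show "\<bar>\<Sum>m=0..M. AM_beta M m * Q (real (M - m))\<bar> \<le> (\<Sum>m=0..M. \<bar>AM_beta M m\<bar> * (K * (real M * h) ^ (M + 1)))"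
    proof (rule order_trans[OF sum_abs sum_mono])
      fix m assume "m \<in> {0..M}"
      have "\<bar>Q (real (M - m))\<bar> \<le> K * (real M * h) ^ (M + 1)" by (rule Q) auto
      then show "\<bar>AM_beta M m * Q (real (M - m))\<bar> \<le> \<bar>AM_beta M m\<bar> * (K * (real M * h) ^ (M + 1))"
        unfolding abs_mult by (rule mult_left_mono) simp
    qed
  qed
  also have "\<dots> = K * (2 * real M ^ (M + 2) + (\<Sum>m=0..M. \<bar>AM_beta M m\<bar>) * real M ^ (M + 1)) * h ^ (M + 1)"
    unfolding sum_distrib_right[symmetric] using h by (simp add: power_mult_distrib field_simps)
  finally show ?thesis .
qed

section \<open>Linear recurrences without characteristic roots on the unit circle\<close>

text \<open>
  The operator \<open>q(S)\<close>, where \<open>S\<close> is the forward shift of sequences.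
\<close>

definition shift_op :: "complex poly \<Rightarrow> (nat \<Rightarrow> complex) \<Rightarrow> nat \<Rightarrow> complex" where
  "shift_op q e k = (\<Sum>j\<le>degree q. coeff q j * e (k + j))"

lemma shift_op_eq:
  assumes "degree q \<le> n"
  shows "shift_op q e k = (\<Sum>j\<le>n. coeff q j * e (k + j))"
  unfolding shift_op_def
  by (rule sum.mono_neutral_left) (use assms in \<open>auto simp: coeff_eq_0\<close>)

lemma shift_op_linear_factor:
  "shift_op ([:- \<mu>, 1:] * q) e k = shift_op q e (Suc k) - \<mu> * shift_op q e k"
proof -
  let ?d = "degree q"
  have c: "coeff ([:- \<mu>, 1:] * q) j = (case j of 0 \<Rightarrow> 0 | Suc i \<Rightarrow> coeff q i) - \<mu> * coeff q j" for j
    by (cases j) (simp_all add: coeff_pCons algebra_simps)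
  have "degree ([:- \<mu>, 1:] * q) \<le> Suc ?d"
    by (rule order_trans[OF degree_mult_le]) simp
  then have "shift_op ([:- \<mu>, 1:] * q) e k = (\<Sum>j\<le>Suc ?d. coeff ([:- \<mu>, 1:] * q) j * e (k + j))"
    by (rule shift_op_eq)
  also have "\<dots> = (\<Sum>j\<le>Suc ?d. (case j of 0 \<Rightarrow> 0 | Suc i \<Rightarrow> coeff q i) * e (k + j))
      - \<mu> * (\<Sum>j\<le>Suc ?d. coeff q j * e (k + j))"
    unfolding c by (simp only: left_diff_distrib sum_subtractf sum_distrib_left mult.assoc)
  also have "(\<Sum>j\<le>Suc ?d. (case j of 0 \<Rightarrow> 0 | Suc i \<Rightarrow> coeff q i) * e (k + j))
      = (\<Sum>j\<le>?d. coeff q j * e (Suc k + j))"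
    by (subst sum.atMost_Suc_shift) simp
  also have "(\<Sum>j\<le>Suc ?d. coeff q j * e (k + j)) = shift_op q e k"
    by (rule shift_op_eq[symmetric]) simp
  finally show ?thesis by (simp add: shift_op_def)
qed

text \<open>
  The strict inequality between the two rates keeps the convolution of two geometric sequences geometric, without a
  polynomial factor. It is what allows an induction over possibly multiple roots with one fixed rate \<open>\<theta>\<close>.
\<close>

lemma geometric_convolution_le:
  fixes \<rho> \<theta> :: real
  assumes "0 \<le> \<rho>" "\<rho> < \<theta>"
  shows "(\<Sum>j<k. \<rho> ^ (k - Suc j) * \<theta> ^ j) \<le> \<theta> ^ k / (\<theta> - \<rho>)"
proof -
  have "(\<theta> - \<rho>) * (\<Sum>j<k. \<rho> ^ (k - Suc j) * \<theta> ^ j) = \<theta> ^ k - \<rho> ^ k"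
    by (rule power_diff_sumr2[symmetric])
  also have "\<dots> \<le> \<theta> ^ k" using assms by simp
  finally show ?thesis using assms by (simp add: field_simps)
qed

text \<open>
  The inhomogeneity may itself contain boundary layers of rate \<open>\<theta>\<close> from both ends, because it comes from the factors
  treated before. Solving forwards, the layer from the left is convolved with powers of a smaller modulus, and the layer from the
  right is dominated by its value at the current index.
\<close>

lemma contracting_recurrence_bound:
  fixes w :: "nat \<Rightarrow> 'a::real_normed_field" and \<theta> :: real
  assumes \<mu>: "norm \<mu> < \<theta>" and \<theta>: "0 < \<theta>" "\<theta> < 1"
    and nn: "0 \<le> \<tau>" "0 \<le> a" "0 \<le> b"
    and rec: "\<And>k. k \<le> L \<Longrightarrow> norm (w (Suc k) - \<mu> * w k) \<le> \<tau> + \<theta> ^ k * a + \<theta> ^ (L - k) * b"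
    and k: "k \<le> Suc L"
  shows "norm (w k) \<le> (1 / (1 - \<theta>) + 1 / (\<theta> - norm \<mu>) + 1 / (\<theta> * (1 - \<theta>))) *
      (\<tau> + \<theta> ^ k * a + \<theta> ^ (Suc L - k) * b) + \<theta> ^ k * norm (w 0)"
proof -
  let ?r = "norm \<mu>"
  let ?c = "\<lambda>k. \<tau> + \<theta> ^ k * a + \<theta> ^ (L - k) * b"
  have 1: "norm (w k) \<le> ?r ^ k * norm (w 0) + (\<Sum>j<k. ?r ^ (k - Suc j) * ?c j)" if "k \<le> Suc L" for k
    using that
  proof (induction k)
    case (Suc k)
    have "norm (w (Suc k)) \<le> norm (w (Suc k) - \<mu> * w k) + ?r * norm (w k)"
      by (metis norm_mult norm_triangle_sub add.commute)
    also have "\<dots> \<le> ?c k + ?r * (?r ^ k * norm (w 0) + (\<Sum>j<k. ?r ^ (k - Suc j) * ?c j))"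
      using Suc by (intro add_mono mult_left_mono rec) auto
    also have "\<dots> = ?c k + (?r * ?r ^ k * norm (w 0) + ?r * (\<Sum>j<k. ?r ^ (k - Suc j) * ?c j))"
      by (simp only: distrib_left mult.assoc)
    also have "?r * (\<Sum>j<k. ?r ^ (k - Suc j) * ?c j) = (\<Sum>j<k. ?r ^ (Suc k - Suc j) * ?c j)"
      unfolding sum_distrib_left
      by (intro sum.cong refl) (simp add: Suc_diff_Suc mult.assoc[symmetric] flip: power_Suc)
    finally show ?case by simp
  qed simp
  have r: "0 \<le> ?r" "?r < 1" using \<mu> \<theta> by auto
  have s1: "(\<Sum>j<k. ?r ^ (k - Suc j)) \<le> 1 / (1 - \<theta>)"
  proof -
    have "(\<Sum>j<k. ?r ^ (k - Suc j)) \<le> 1 / (1 - ?r)"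
      using geometric_convolution_le[of ?r 1 k] r by simp
    also have "\<dots> \<le> 1 / (1 - \<theta>)" using \<mu> \<theta> r by (intro divide_left_mono) auto
    finally show ?thesis .
  qed
  have s2: "(\<Sum>j<k. ?r ^ (k - Suc j) * \<theta> ^ j) \<le> \<theta> ^ k / (\<theta> - ?r)"
    by (rule geometric_convolution_le) (use \<mu> in auto)
  have s3: "(\<Sum>j<k. ?r ^ (k - Suc j) * \<theta> ^ (L - j)) \<le> \<theta> ^ (Suc L - k) * (1 / (\<theta> * (1 - \<theta>)))"
  proof -
    have "?r ^ (k - Suc j) * \<theta> ^ (L - j) \<le> \<theta> ^ (Suc L - k) * ((1 / \<theta>) * \<theta> ^ (k - Suc j))" if "j < k" for j
    proof -
      have "?r ^ (k - Suc j) \<le> 1" using r by (intro power_le_one) auto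
      then have "?r ^ (k - Suc j) * \<theta> ^ (L - j) \<le> \<theta> ^ (L - j)"
        using \<theta> by (intro mult_left_le_one_le) auto
      also have "\<theta> ^ (L - j) = \<theta> ^ (Suc L - k) * \<theta> ^ (k - Suc j)"
        using that k by (simp flip: power_add)
      also have "\<dots> \<le> \<theta> ^ (Suc L - k) * ((1 / \<theta>) * \<theta> ^ (k - Suc j))"
        using \<theta> by (intro mult_left_mono) (auto simp: field_simps)
      finally show ?thesis .
    qed
    then have "(\<Sum>j<k. ?r ^ (k - Suc j) * \<theta> ^ (L - j))
        \<le> (\<Sum>j<k. \<theta> ^ (Suc L - k) * ((1 / \<theta>) * \<theta> ^ (k - Suc j)))"
      by (intro sum_mono) auto
    also have "\<dots> = \<theta> ^ (Suc L - k) * ((1 / \<theta>) * (\<Sum>j<k. \<theta> ^ (k - Suc j)))"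
      by (simp add: sum_distrib_left)
    also have "\<dots> \<le> \<theta> ^ (Suc L - k) * ((1 / \<theta>) * (1 / (1 - \<theta>)))"
      using geometric_convolution_le[of \<theta> 1 k] \<theta> by (intro mult_left_mono) auto
    finally show ?thesis by simp
  qed
  let ?A = "1 / (1 - \<theta>)" and ?B = "1 / (\<theta> - ?r)" and ?D = "1 / (\<theta> * (1 - \<theta>))"
  have nnABD: "0 \<le> ?A" "0 \<le> ?B" "0 \<le> ?D" using \<mu> \<theta> by auto
  have "(\<Sum>j<k. ?r ^ (k - Suc j) * ?c j)
     = (\<Sum>j<k. ?r ^ (k - Suc j)) * \<tau> + (\<Sum>j<k. ?r ^ (k - Suc j) * \<theta> ^ j) * a
       + (\<Sum>j<k. ?r ^ (k - Suc j) * \<theta> ^ (L - j)) * b"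
    by (simp add: sum_distrib_right sum.distrib distrib_left mult.assoc)
  also have "\<dots> \<le> ?A * \<tau> + (\<theta> ^ k * ?B) * a + (\<theta> ^ (Suc L - k) * ?D) * b"
    using s1 s2 s3 nn by (intro add_mono mult_right_mono) auto
  also have "\<dots> = ?A * \<tau> + ?B * (\<theta> ^ k * a) + ?D * (\<theta> ^ (Suc L - k) * b)"
    by (simp add: mult_ac)
  also have "\<dots> \<le> (?A + ?B + ?D) * \<tau> + (?A + ?B + ?D) * (\<theta> ^ k * a) + (?A + ?B + ?D) * (\<theta> ^ (Suc L - k) * b)"
    using nnABD nn \<theta> by (intro add_mono mult_right_mono mult_nonneg_nonneg zero_le_power) linarith+
  also have "\<dots> = (?A + ?B + ?D) * (\<tau> + \<theta> ^ k * a + \<theta> ^ (Suc L - k) * b)"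
    by (simp add: algebra_simps)
  finally have "(\<Sum>j<k. ?r ^ (k - Suc j) * ?c j) \<le> \<dots>" .
  moreover have "?r ^ k * norm (w 0) \<le> \<theta> ^ k * norm (w 0)"
    using \<mu> r by (intro mult_right_mono power_mono) auto
  ultimately show ?thesis using 1[OF k] by linarith
qed

text \<open>
  Reversing the index turns the root \<open>\<mu>\<close> into \<open>1 / \<mu>\<close>, whose modulus is less than \<open>\<theta>\<close>, and exchanges the two boundary layers.
\<close>

lemma expanding_recurrence_bound:
  fixes w :: "nat \<Rightarrow> 'a::real_normed_field" and \<theta> :: real
  assumes \<mu>: "inverse (norm \<mu>) < \<theta>" "\<mu> \<noteq> 0" and \<theta>: "0 < \<theta>" "\<theta> < 1"
    and nn: "0 \<le> \<tau>" "0 \<le> a" "0 \<le> b"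
    and rec: "\<And>k. k \<le> L \<Longrightarrow> norm (w (Suc k) - \<mu> * w k) \<le> \<tau> + \<theta> ^ k * a + \<theta> ^ (L - k) * b"
    and k: "k \<le> Suc L"
  shows "norm (w k) \<le> (1 / (1 - \<theta>) + 1 / (\<theta> - inverse (norm \<mu>)) + 1 / (\<theta> * (1 - \<theta>))) *
      (\<tau> + \<theta> ^ k * a + \<theta> ^ (Suc L - k) * b) + \<theta> ^ (Suc L - k) * norm (w (Suc L))"
proof -
  define w' where "w' k = w (Suc L - k)" for k
  have "norm (w' (Suc k) - inverse \<mu> * w' k) \<le> \<tau> + \<theta> ^ k * b + \<theta> ^ (L - k) * a" if "k \<le> L" for k
  proof -
    have eq: "w' (Suc k) - inverse \<mu> * w' k = - (inverse \<mu> * (w (Suc (L - k)) - \<mu> * w (L - k)))"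
      using that \<mu>(2) by (simp add: w'_def Suc_diff_le field_simps)
    have "norm (w' (Suc k) - inverse \<mu> * w' k) = inverse (norm \<mu>) * norm (w (Suc (L - k)) - \<mu> * w (L - k))"
      unfolding eq by (simp add: norm_mult norm_inverse)
    also have "\<dots> \<le> 1 * norm (w (Suc (L - k)) - \<mu> * w (L - k))"
      using \<mu> \<theta> by (intro mult_right_mono) auto
    also have "\<dots> \<le> \<tau> + \<theta> ^ (L - k) * a + \<theta> ^ (L - (L - k)) * b"
      using rec[of "L - k"] by simp
    finally show ?thesis using that by simp
  qed
  from contracting_recurrence_bound[of "inverse \<mu>" \<theta> \<tau> b a L w' "Suc L - k", OF _ \<theta> nn(1,3,2) this]
  show ?thesis using \<mu> k by (simp add: w'_def norm_inverse add_ac)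
qed

text \<open>
  Induction over the degree. One linear factor \<open>S - \<mu>\<close> is split off and solved as a first-order recurrence for the sequence \<open>w = q'(S) e\<close>,
  from the left or from the right according to the modulus of \<open>\<mu>\<close>. Its initial or final value is bounded by the
  prescribed entries of \<open>e\<close> in the respective boundary layer. The bound for \<open>w\<close> has the shape that the induction hypothesis
  expects of an inhomogeneity, with one more equation.
\<close>

lemma hyperbolic_recurrence_bound:
  fixes q :: "complex poly" and \<theta> :: real
  assumes "q \<noteq> 0" and \<theta>: "0 < \<theta>" "\<theta> < 1"
    and roots: "\<forall>z. poly q z = 0 \<longrightarrow> cmod z < \<theta> \<or> z \<noteq> 0 \<and> inverse (cmod z) < \<theta>"
  shows "\<exists>C\<ge>0. \<forall>L e \<tau> a b. 0 \<le> \<tau> \<longrightarrow> 0 \<le> a \<longrightarrow> 0 \<le> b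
      \<longrightarrow> (\<forall>k\<le>L. cmod (shift_op q e k) \<le> \<tau> + \<theta> ^ k * a + \<theta> ^ (L - k) * b)
      \<longrightarrow> (\<forall>j<degree q. cmod (e j) \<le> a \<and> cmod (e (L + degree q - j)) \<le> b)
      \<longrightarrow> (\<forall>k\<le>L + degree q. cmod (e k) \<le> C * (\<tau> + \<theta> ^ k * a + \<theta> ^ (L + degree q - k) * b))"
  using assms(1) roots
proof (induction "degree q" arbitrary: q)
  case 0
  then obtain c where q: "q = [:c:]" by (auto elim: degree_eq_zeroE)
  with 0 have c: "c \<noteq> 0" by simp
  show ?case
  proof (intro exI[of _ "inverse (cmod c)"] conjI allI impI)
    fix L k :: nat and \<tau> a b :: real and e
    assume h: "\<forall>k\<le>L. cmod (shift_op q e k) \<le> \<tau> + \<theta> ^ k * a + \<theta> ^ (L - k) * b" "k \<le> L + degree q"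
    then have "cmod c * cmod (e k) \<le> \<tau> + \<theta> ^ k * a + \<theta> ^ (L - k) * b"
      by (auto simp: q shift_op_def norm_mult)
    then show "cmod (e k) \<le> inverse (cmod c) * (\<tau> + \<theta> ^ k * a + \<theta> ^ (L + degree q - k) * b)"
      using c by (simp add: q field_simps)
  qed simp
next
  case (Suc d)
  have "\<not> constant (poly q)" using Suc(2) by (simp add: constant_degree)
  then obtain \<mu> where \<mu>: "poly q \<mu> = 0" using fundamental_theorem_of_algebra by blast
  then obtain q' where q: "q = [:- \<mu>, 1:] * q'" by (auto simp: poly_eq_0_iff_dvd)
  have q': "q' \<noteq> 0" using Suc.prems(1) q by auto
  then have d: "degree q = Suc (degree q')" unfolding q by (subst degree_mult_eq) auto
  with Suc(2) have d': "d = degree q'" by simp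
  have roots': "\<forall>z. poly q' z = 0 \<longrightarrow> cmod z < \<theta> \<or> z \<noteq> 0 \<and> inverse (cmod z) < \<theta>"
    using Suc.prems(2) unfolding q by simp
  obtain C where C: "C \<ge> 0" and
    IH: "\<forall>L e \<tau> a b. 0 \<le> \<tau> \<longrightarrow> 0 \<le> a \<longrightarrow> 0 \<le> b
      \<longrightarrow> (\<forall>k\<le>L. cmod (shift_op q' e k) \<le> \<tau> + \<theta> ^ k * a + \<theta> ^ (L - k) * b)
      \<longrightarrow> (\<forall>j<degree q'. cmod (e j) \<le> a \<and> cmod (e (L + degree q' - j)) \<le> b)
      \<longrightarrow> (\<forall>k\<le>L + degree q'. cmod (e k) \<le> C * (\<tau> + \<theta> ^ k * a + \<theta> ^ (L + degree q' - k) * b))"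
    using Suc(1)[OF d' q' roots'] by (elim exE conjE) blast
  define S where "S = (\<Sum>j\<le>degree q'. cmod (coeff q' j))"
  define D where "D = 1 / (1 - \<theta>) + 1 / (\<theta> * (1 - \<theta>)) + \<bar>1 / (\<theta> - cmod \<mu>)\<bar> + \<bar>1 / (\<theta> - inverse (cmod \<mu>))\<bar>"
  have S: "S \<ge> 0" unfolding S_def by (intro sum_nonneg) auto
  have D: "D \<ge> 0" unfolding D_def using \<theta> by simp
  have shift_le: "cmod (shift_op q' e k) \<le> S * a" if "\<And>j. j \<le> degree q' \<Longrightarrow> cmod (e (k + j)) \<le> a" for e k a
  proof -
    have "cmod (shift_op q' e k) \<le> (\<Sum>j\<le>degree q'. cmod (coeff q' j) * a)"
      unfolding shift_op_def
      by (rule order_trans[OF norm_sum sum_mono])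
        (auto simp: norm_mult that mult_left_mono)
    then show ?thesis by (simp add: S_def sum_distrib_right)
  qed
  show ?case
  proof (intro exI[of _ "C * (D + S + 1)"] conjI allI impI)
    show "0 \<le> C * (D + S + 1)" using C D S by simp
    fix L k :: nat and \<tau> a b :: real and e
    assume nn: "0 \<le> \<tau>" "0 \<le> a" "0 \<le> b"
      and eq: "\<forall>k\<le>L. cmod (shift_op q e k) \<le> \<tau> + \<theta> ^ k * a + \<theta> ^ (L - k) * b"
      and bd: "\<forall>j<degree q. cmod (e j) \<le> a \<and> cmod (e (L + degree q - j)) \<le> b"
      and k: "k \<le> L + degree q"
    have rec: "cmod (shift_op q' e (Suc k) - \<mu> * shift_op q' e k) \<le> \<tau> + \<theta> ^ k * a + \<theta> ^ (L - k) * b"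
      if "k \<le> L" for k
      using eq that unfolding q shift_op_linear_factor by simp
    have w0: "cmod (shift_op q' e 0) \<le> S * a"
      by (rule shift_le) (use bd d in auto)
    have wL: "cmod (shift_op q' e (Suc L)) \<le> S * b"
    proof (rule shift_le)
      fix j assume "j \<le> degree q'"
      then show "cmod (e (Suc L + j)) \<le> b"
        using bd[rule_format, of "degree q' - j"] d by (simp add: Suc_diff_le)
    qed
    have main: "cmod (shift_op q' e k) \<le> (D + S + 1) * \<tau> + \<theta> ^ k * ((D + S + 1) * a) + \<theta> ^ (Suc L - k) * ((D + S + 1) * b)"
      if k: "k \<le> Suc L" for k
    proof -
      let ?X = "\<tau> + \<theta> ^ k * a + \<theta> ^ (Suc L - k) * b"
      have X: "0 \<le> ?X" "0 \<le> \<theta> ^ k * a" "0 \<le> \<theta> ^ (Suc L - k) * b" using nn \<theta> by auto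
      have "cmod (shift_op q' e k) \<le> D * ?X + (\<theta> ^ k * (S * a) + \<theta> ^ (Suc L - k) * (S * b))"
      proof (cases "cmod \<mu> < \<theta>")
        case True
        have "cmod (shift_op q' e k) \<le> (1 / (1 - \<theta>) + 1 / (\<theta> - cmod \<mu>) + 1 / (\<theta> * (1 - \<theta>))) * ?X
            + \<theta> ^ k * cmod (shift_op q' e 0)"
          by (rule contracting_recurrence_bound[OF True \<theta> nn rec k])
        also have "\<dots> \<le> D * ?X + \<theta> ^ k * (S * a)"
        proof (intro add_mono mult_right_mono mult_left_mono)
          show "1 / (1 - \<theta>) + 1 / (\<theta> - cmod \<mu>) + 1 / (\<theta> * (1 - \<theta>)) \<le> D"
            unfolding D_def using abs_ge_self[of "1 / (\<theta> - cmod \<mu>)"] abs_ge_zero[of "1 / (\<theta> - inverse (cmod \<mu>))"] by linarith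
        qed (use X(1) w0 \<theta> in auto)
        finally show ?thesis using X S nn \<theta> by (smt (verit) mult_nonneg_nonneg zero_le_power)
      next
        case False
        with Suc.prems(2) \<mu> have l: "inverse (cmod \<mu>) < \<theta>" "\<mu> \<noteq> 0" by auto
        have "cmod (shift_op q' e k) \<le> (1 / (1 - \<theta>) + 1 / (\<theta> - inverse (cmod \<mu>)) + 1 / (\<theta> * (1 - \<theta>))) * ?X
            + \<theta> ^ (Suc L - k) * cmod (shift_op q' e (Suc L))"
          by (rule expanding_recurrence_bound[OF l \<theta> nn rec k])
        also have "\<dots> \<le> D * ?X + \<theta> ^ (Suc L - k) * (S * b)"
        proof (intro add_mono mult_right_mono mult_left_mono)
          show "1 / (1 - \<theta>) + 1 / (\<theta> - inverse (cmod \<mu>)) + 1 / (\<theta> * (1 - \<theta>)) \<le> D"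
            unfolding D_def using abs_ge_self[of "1 / (\<theta> - inverse (cmod \<mu>))"] abs_ge_zero[of "1 / (\<theta> - cmod \<mu>)"] by linarith
        qed (use X(1) wL \<theta> in auto)
        finally show ?thesis using X S nn \<theta> by (smt (verit) mult_nonneg_nonneg zero_le_power)
      qed
      also have "\<dots> = (D + S + 1) * ?X - (?X + S * \<tau>)" by (simp add: algebra_simps)
      also have "\<dots> \<le> (D + S + 1) * ?X" using X(1) mult_nonneg_nonneg[OF S nn(1)] by linarith
      finally show ?thesis by (simp add: algebra_simps)
    qed
    let ?G = "D + S + 1"
    have G: "?G \<ge> 1" using D S by simp
    have ge: "a \<le> ?G * a" "b \<le> ?G * b" using G nn by (simp_all add: mult_le_cancel_right1)
    have "cmod (e k) \<le> C * (?G * \<tau> + \<theta> ^ k * (?G * a) + \<theta> ^ (Suc L + degree q' - k) * (?G * b))"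
    proof (rule IH[rule_format, where L = "Suc L"])
      fix j assume "j < degree q'"
      then show "cmod (e j) \<le> ?G * a \<and> cmod (e (Suc L + degree q' - j)) \<le> ?G * b"
        using bd[rule_format, of j] ge d by auto
    qed (use nn G main k d in auto)
    then show "cmod (e k) \<le> C * ?G * (\<tau> + \<theta> ^ k * a + \<theta> ^ (L + degree q - k) * b)"
      unfolding d by (simp add: algebra_simps)
  qed
qed

section \<open>Stability of the Adams--Moulton recurrence\<close>

lemma coeff_AM_poly: "coeff (AM_poly M) j = (if j \<le> M then complex_of_real (AM_beta M (M - j)) else 0)"
proof -
  have "coeff (AM_poly M) j = (\<Sum>m=0..M. if M - m = j then complex_of_real (AM_beta M m) else 0)"
    by (simp add: AM_poly_def coeff_sum)
  also have "\<dots> = (\<Sum>m=0..M. if m = M - j \<and> j \<le> M then complex_of_real (AM_beta M m) else 0)"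
    by (intro sum.cong) auto
  finally show ?thesis by (cases "j \<le> M") (simp_all add: sum.delta)
qed

lemma degree_AM_poly: "degree (AM_poly M) = M"
  using AM_beta_0_pos[of M] by (intro antisym degree_le le_degree) (auto simp: coeff_AM_poly)

lemma AM_poly_nonzero: "AM_poly M \<noteq> 0"
  using coeff_AM_poly[of M M] AM_beta_0_pos[of M] by auto

lemma shift_op_AM_poly:
  "shift_op (AM_poly M) (\<lambda>j. complex_of_real (e j)) k = complex_of_real (\<Sum>m=0..M. AM_beta M m * e (k + M - m))"
proof -
  have "shift_op (AM_poly M) (\<lambda>j. complex_of_real (e j)) k
      = (\<Sum>j\<le>M. complex_of_real (AM_beta M (M - j) * e (k + j)))"
    by (simp add: shift_op_def degree_AM_poly coeff_AM_poly)
  also have "\<dots> = (\<Sum>m=0..M. complex_of_real (AM_beta M m * e (k + M - m)))"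
    by (rule sum.reindex_bij_witness[of _ "\<lambda>j. M - j" "\<lambda>j. M - j"]) auto
  finally show ?thesis by simp
qed

text \<open>
  The equation at \<open>n = k + M\<close> is the shift operator of the characteristic polynomial evaluated at \<open>k\<close>. The two
  boundary layers consist of \<open>M\<close> entries each since \<open>\<beta>\<^sub>0 \<noteq> 0\<close> makes \<open>M\<close> the degree.
\<close>

lemma AM_node_error_bound:
  assumes \<theta>: "0 < \<theta>" "\<theta> < 1"
    and roots: "\<forall>z. poly (AM_poly M) z = 0 \<longrightarrow> cmod z < \<theta> \<or> z \<noteq> 0 \<and> inverse (cmod z) < \<theta>"
  shows "\<exists>K\<ge>0. \<forall>N (e :: nat \<Rightarrow> real) \<tau>. M \<le> N \<longrightarrow> 0 \<le> \<tau>
      \<longrightarrow> (\<forall>n\<in>{M..N}. \<bar>\<Sum>m=0..M. AM_beta M m * e (n - m)\<bar> \<le> \<tau>)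
      \<longrightarrow> (\<forall>k\<le>N. \<bar>e k\<bar> \<le> K * (\<tau> + \<theta> ^ k * (\<Sum>j=0..<M. \<bar>e j\<bar>) + \<theta> ^ (N - k) * (\<Sum>j=N-M+1..N. \<bar>e j\<bar>)))"
proof -
  from hyperbolic_recurrence_bound[OF AM_poly_nonzero \<theta> roots] obtain C where C: "C \<ge> 0"
    and bd: "\<forall>L e \<tau> a b. 0 \<le> \<tau> \<longrightarrow> 0 \<le> a \<longrightarrow> 0 \<le> b
      \<longrightarrow> (\<forall>k\<le>L. cmod (shift_op (AM_poly M) e k) \<le> \<tau> + \<theta> ^ k * a + \<theta> ^ (L - k) * b)
      \<longrightarrow> (\<forall>j<degree (AM_poly M). cmod (e j) \<le> a \<and> cmod (e (L + degree (AM_poly M) - j)) \<le> b)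
      \<longrightarrow> (\<forall>k\<le>L + degree (AM_poly M). cmod (e k) \<le> C * (\<tau> + \<theta> ^ k * a + \<theta> ^ (L + degree (AM_poly M) - k) * b))"
    by (elim exE conjE)
  show ?thesis
  proof (intro exI[of _ C] conjI C allI impI)
    fix N k :: nat and e :: "nat \<Rightarrow> real" and \<tau> :: real
    assume N: "M \<le> N" and \<tau>: "0 \<le> \<tau>" and eq: "\<forall>n\<in>{M..N}. \<bar>\<Sum>m=0..M. AM_beta M m * e (n - m)\<bar> \<le> \<tau>" and k: "k \<le> N"
    define a where "a = (\<Sum>j=0..<M. \<bar>e j\<bar>)"
    define b where "b = (\<Sum>j=N-M+1..N. \<bar>e j\<bar>)"
    have nn: "0 \<le> a" "0 \<le> b" by (auto simp: a_def b_def intro: sum_nonneg)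
    have "cmod (complex_of_real (e k)) \<le> C * (\<tau> + \<theta> ^ k * a + \<theta> ^ (N - M + degree (AM_poly M) - k) * b)"
    proof (rule bd[rule_format, where L = "N - M" and e = "\<lambda>j. complex_of_real (e j)"])
      fix l assume l: "l \<le> N - M"
      have "cmod (shift_op (AM_poly M) (\<lambda>j. complex_of_real (e j)) l) \<le> \<tau>"
        using eq[rule_format, of "l + M"] l N unfolding shift_op_AM_poly norm_of_real by simp
      moreover have "0 \<le> \<theta> ^ l * a" "0 \<le> \<theta> ^ (N - M - l) * b" using nn \<theta> by auto
      ultimately show "cmod (shift_op (AM_poly M) (\<lambda>j. complex_of_real (e j)) l) \<le> \<tau> + \<theta> ^ l * a + \<theta> ^ (N - M - l) * b"
        by linarith
    next
      fix j assume "j < degree (AM_poly M)"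
      then have j: "j < M" by (simp add: degree_AM_poly)
      have "\<bar>e j\<bar> \<le> a" unfolding a_def using j by (intro member_le_sum) auto
      moreover have "\<bar>e (N - j)\<bar> \<le> b" unfolding b_def using j N by (intro member_le_sum) auto
      ultimately show "cmod (complex_of_real (e j)) \<le> a \<and> cmod (complex_of_real (e (N - M + degree (AM_poly M) - j))) \<le> b"
        using N by (simp add: degree_AM_poly)
    qed (use \<tau> nn k N in \<open>auto simp: degree_AM_poly\<close>)
    then show "\<bar>e k\<bar> \<le> C * (\<tau> + \<theta> ^ k * (\<Sum>j=0..<M. \<bar>e j\<bar>) + \<theta> ^ (N - k) * (\<Sum>j=N-M+1..N. \<bar>e j\<bar>))"
      using N by (simp add: degree_AM_poly a_def b_def)
  qed
qed

lemma finite_AM_root_moduli: "finite {g (cmod z) | z. poly (AM_poly M) z = 0 \<and> P z}"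
proof -
  have "{g (cmod z) | z. poly (AM_poly M) z = 0 \<and> P z} \<subseteq> (\<lambda>z. g (cmod z)) ` {z. poly (AM_poly M) z = 0}"
    by auto
  then show ?thesis using poly_roots_finite[OF AM_poly_nonzero] finite_subset by blast
qed

lemma Max0_ge: "finite S \<Longrightarrow> s \<in> S \<Longrightarrow> s \<le> Max0 S"
  by (auto simp: Max0_def)

lemma AM_rho_less_1: "AM_rho M < 1"
proof -
  have *: "Max0 S < 1" if "finite S" "\<And>s. s \<in> S \<Longrightarrow> s < 1" for S
    using that by (auto simp: Max0_def)
  have "Max0 {cmod z | z. poly (AM_poly M) z = 0 \<and> cmod z < 1} < 1"
    by (rule *[OF finite_AM_root_moduli[of "\<lambda>r. r"]]) auto
  moreover have "Max0 {inverse (cmod z) | z. poly (AM_poly M) z = 0 \<and> cmod z > 1} < 1"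
    by (rule *[OF finite_AM_root_moduli]) (auto simp: inverse_less_1_iff)
  ultimately show ?thesis by (simp add: AM_rho_def)
qed

lemma AM_rho_nonneg: "0 \<le> AM_rho M"
proof -
  have "Max0 {cmod z | z. poly (AM_poly M) z = 0 \<and> cmod z < 1} \<ge> 0"
    using finite_AM_root_moduli[of "\<lambda>r. r" M "\<lambda>z. cmod z < 1"]
    by (auto simp: Max0_def Max_ge_iff)
  then show ?thesis by (simp add: AM_rho_def)
qed

lemma AM_roots_separated:
  assumes "\<And>z. cmod z = 1 \<Longrightarrow> poly (AM_poly M) z \<noteq> 0" and \<theta>: "AM_rho M < \<theta>"
  shows "\<forall>z. poly (AM_poly M) z = 0 \<longrightarrow> cmod z < \<theta> \<or> z \<noteq> 0 \<and> inverse (cmod z) < \<theta>"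
proof (intro allI impI)
  fix z assume z: "poly (AM_poly M) z = 0"
  then consider "cmod z < 1" | "cmod z > 1" using assms(1) by fastforce
  then show "cmod z < \<theta> \<or> z \<noteq> 0 \<and> inverse (cmod z) < \<theta>"
  proof cases
    case 1
    then have "cmod z \<le> AM_rho M"
      unfolding AM_rho_def using z finite_AM_root_moduli[of "\<lambda>r. r"] by (intro max.coboundedI1 Max0_ge) auto
    then show ?thesis using \<theta> by simp
  next
    case 2
    then have "inverse (cmod z) \<le> AM_rho M"
      unfolding AM_rho_def using z finite_AM_root_moduli[of inverse] by (intro max.coboundedI2 Max0_ge) auto
    then show ?thesis using \<theta> 2 by auto
  qed
qed

text \<open>
  The number of steps satisfies \<open>n + 1 \<ge> \<delta> / h\<close>, that is \<open>h \<ge> \<delta> / (n + 1)\<close>, so it suffices that \<open>(n + 1)^p \<theta>^n B\<close> is at most \<open>\<delta>^p\<close> for large \<open>n\<close>.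
\<close>

lemma geometric_dominated_by_step_power:
  fixes \<theta> \<delta> B :: real
  assumes \<theta>: "0 < \<theta>" "\<theta> < 1" and \<delta>: "0 < \<delta>" and p: "0 < p" and B: "0 \<le> B"
  shows "\<exists>h0>0. \<forall>h n. 0 < h \<longrightarrow> h < h0 \<longrightarrow> \<delta> / h - 1 \<le> real n \<longrightarrow> \<theta> ^ n * B \<le> h ^ p"
proof -
  \<comment> \<open>With \<open>\<kappa>^p = \<theta>\<close> the quantity \<open>n^p \<theta>^n\<close> is the power \<open>(n \<kappa>^n)^p\<close> of a null sequence.\<close>
  define \<kappa> where "\<kappa> = root p \<theta>"
  have \<kappa>: "\<kappa> ^ p = \<theta>" "0 < \<kappa>" "\<kappa> < 1"
    using \<theta> p by (auto simp: \<kappa>_def)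
  have "(\<lambda>n. real n * \<kappa> ^ n) \<longlonglongrightarrow> 0"
    by (rule powser_times_n_limit_0) (use \<kappa> in auto)
  then have "(\<lambda>n. real (Suc n) * \<kappa> ^ Suc n) \<longlonglongrightarrow> 0" by (rule LIMSEQ_Suc)
  then have "(\<lambda>n. (real (Suc n) * \<kappa> ^ Suc n) ^ p * (B / \<theta>)) \<longlonglongrightarrow> 0 ^ p * (B / \<theta>)"
    by (intro tendsto_intros)
  then have "(\<lambda>n. (real (Suc n) * \<kappa> ^ Suc n) ^ p * (B / \<theta>)) \<longlonglongrightarrow> 0"
    using p by (simp add: zero_power)
  then have "eventually (\<lambda>n. (real (Suc n) * \<kappa> ^ Suc n) ^ p * (B / \<theta>) < \<delta> ^ p) sequentially"
    by (rule order_tendstoD) (use \<delta> in auto)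
  then obtain n0 where n0: "\<And>n. n \<ge> n0 \<Longrightarrow> (real (Suc n) * \<kappa> ^ Suc n) ^ p * (B / \<theta>) < \<delta> ^ p"
    by (auto simp: eventually_sequentially)
  show ?thesis
  proof (intro exI[of _ "\<delta> / real (Suc n0)"] conjI allI impI)
    show "0 < \<delta> / real (Suc n0)" using \<delta> by simp
    fix h :: real and n :: nat
    assume h: "0 < h" "h < \<delta> / real (Suc n0)" and n: "\<delta> / h - 1 \<le> real n"
    have "real (Suc n0) < \<delta> / h" using h by (simp add: field_simps)
    then have "n \<ge> n0" using n by simp
    have "\<delta> \<le> real (Suc n) * h" using n h by (simp add: field_simps)
    then have "\<delta> ^ p \<le> (real (Suc n) * h) ^ p" using \<delta> by (intro power_mono) auto
    with n0[OF \<open>n \<ge> n0\<close>] have "(real (Suc n) * \<kappa> ^ Suc n) ^ p * (B / \<theta>) \<le> (real (Suc n) * h) ^ p"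
      by linarith
    also have "(real (Suc n) * \<kappa> ^ Suc n) ^ p * (B / \<theta>) = real (Suc n) ^ p * (\<theta> ^ n * B)"
    proof -
      have "(\<kappa> ^ Suc n) ^ p = \<theta> ^ Suc n"
        by (metis \<kappa>(1) power_mult mult.commute)
      then show ?thesis using \<theta> by (simp add: power_mult_distrib del: of_nat_Suc)
    qed
    finally show "\<theta> ^ n * B \<le> h ^ p"
      by (simp add: power_mult_distrib del: of_nat_Suc)
  qed
qed

text \<open>
  The first of the derivatives supplied by the regularity class agrees with the vector field, as one-sided derivatives on a nondegenerate
  interval are unique. This transfers the smoothness of the solution to \<open>f\<close> along the trajectory.
\<close>

lemma solution_component_derivatives:
  fixes x :: "real \<Rightarrow> real ^ 'd"
  assumes T: "0 < T" and n: "0 < n"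
    and ode: "\<And>t. t \<in> {0..T} \<Longrightarrow> (x has_vector_derivative F (x t)) (at t within {0..T})"
    and Ck: "Ck_on n {0..T} x"
  shows "\<exists>d :: nat \<Rightarrow> real \<Rightarrow> real. (\<forall>t\<in>{0..T}. d 0 t = x t $ i) \<and> (\<forall>t\<in>{0..T}. d 1 t = F (x t) $ i)
    \<and> (\<forall>j<n. \<forall>t\<in>{0..T}. (d j has_real_derivative d (Suc j) t) (at t within {0..T}))
    \<and> continuous_on {0..T} (d n)"
proof -
  from Ck obtain D where D0: "\<And>t. t \<in> {0..T} \<Longrightarrow> D 0 t = x t"
    and D: "\<And>j t. j < n \<Longrightarrow> t \<in> {0..T} \<Longrightarrow> (D j has_vector_derivative D (Suc j) t) (at t within {0..T})"
    and Dcont: "continuous_on {0..T} (D n)"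
    unfolding Ck_on_def by blast
  show ?thesis
  proof (intro exI[of _ "\<lambda>j t. D j t $ i"] conjI ballI allI impI)
    show "D 0 t $ i = x t $ i" if "t \<in> {0..T}" for t using D0[OF that] by simp
    show "((\<lambda>t. D j t $ i) has_real_derivative D (Suc j) t $ i) (at t within {0..T})"
      if "j < n" "t \<in> {0..T}" for j t
      using bounded_linear.has_vector_derivative[OF bounded_linear_vec_nth D[OF that], of i]
      by (simp add: has_real_derivative_iff_has_vector_derivative)
    show "D 1 t $ i = F (x t) $ i" if t: "t \<in> {0..T}" for t
    proof -
      have "(x has_vector_derivative D 1 t) (at t within {0..T})"
        using has_vector_derivative_transform[OF t _ D[OF n t]] D0 by simp
      then have "D 1 t = F (x t)"
        using vector_derivative_unique_within_closed_interval[OF T, unfolded cbox_interval, OF t _ ode[OF t]]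
        by simp
      then show ?thesis by simp
    qed
    show "continuous_on {0..T} (\<lambda>t. D n t $ i)" by (intro continuous_intros Dcont)
  qed
qed

lemma trace_error_continuous:
  fixes x :: "real \<Rightarrow> real ^ 'd"
  assumes T: "0 < T"
    and ode: "\<And>t. t \<in> {0..T} \<Longrightarrow> (x has_vector_derivative F (x t)) (at t within {0..T})"
    and Ck: "Ck_on (Suc (Suc n)) {0..T} x" and dom: "x ` {0..T} \<subseteq> \<Omega>"
    and u: "continuous_on \<Omega> u" and f: "f = (\<lambda>y. F y $ i)"
  shows "continuous_on {0..T} (\<lambda>t. u (x t) - f (x t))"
proof -
  have x: "continuous_on {0..T} x"
    unfolding continuous_on_eq_continuous_within using has_vector_derivative_continuous[OF ode] by simp
  obtain d where d1: "\<And>t. t \<in> {0..T} \<Longrightarrow> d 1 t = F (x t) $ i"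
    and d: "\<And>j t. j < Suc (Suc n) \<Longrightarrow> t \<in> {0..T} \<Longrightarrow> (d j has_real_derivative d (Suc j) t) (at t within {0..T})"
    using solution_component_derivatives[OF T zero_less_Suc ode Ck, of i] by blast
  have "continuous (at t within {0..T}) (d 1)" if "t \<in> {0..T}" for t
    by (rule DERIV_continuous[OF d[of 1 t]]) (use that in auto)
  then have "continuous_on {0..T} (d 1)"
    by (simp add: continuous_on_eq_continuous_within)
  then have "continuous_on {0..T} (\<lambda>t. f (x t))"
    using d1 continuous_on_cong[of "{0..T}" "{0..T}" "d 1" "\<lambda>t. f (x t)"] by (simp add: f)
  with continuous_on_compose2[OF u x dom] show ?thesis by (intro continuous_on_diff)
qed

text \<open>
  The common source of both estimates of the theorem: the error over an arbitrary range of cells, with the geometric weights of the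
  boundary layers left unsummed.
\<close>

lemma zero_residual_integral_bound:
  fixes x :: "real \<Rightarrow> real ^ 'd" and f :: "real ^ 'd \<Rightarrow> real"
  assumes T: "0 < T" and M: "1 \<le> M"
    and ode: "\<And>t. t \<in> {0..T} \<Longrightarrow> (x has_vector_derivative F (x t)) (at t within {0..T})"
    and Ck: "Ck_on (M + 2) {0..T} x" and f: "f = (\<lambda>y. F y $ i)"
    and dom: "x ` {0..T} \<subseteq> \<Omega>" and A: "A \<subseteq> {u. continuous_on \<Omega> u}"
    and \<theta>: "0 < \<theta>" "\<theta> < 1"
    and roots: "\<forall>z. poly (AM_poly M) z = 0 \<longrightarrow> cmod z < \<theta> \<or> z \<noteq> 0 \<and> inverse (cmod z) < \<theta>"
  shows "\<exists>C>0. \<forall>N\<ge>M. \<forall>R>0. \<forall>u\<in>trace_class T (M + 1) x f A R. AM_loss M T N x i u = 0 \<longrightarrow>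
    (\<forall>n0 n1. n0 \<le> n1 \<longrightarrow> n1 \<le> N \<longrightarrow>
      integral {node T N n0..node T N n1} (\<lambda>t. \<bar>u (x t) - f (x t)\<bar>)
      \<le> C * (step T N * (\<Sum>k=n0..<n1. step T N ^ (M + 1) + \<theta> ^ k * err_0 M T N x f u + \<theta> ^ (N - k) * err_T M T N x f u)
           + step T N ^ (M + 1) * R))"
proof -
  have "0 < M + 2" by simp
  from solution_component_derivatives[OF T this ode Ck, of i]
  obtain d where d0: "\<And>t. t \<in> {0..T} \<Longrightarrow> d 0 t = x t $ i"
    and d1: "\<And>t. t \<in> {0..T} \<Longrightarrow> d 1 t = F (x t) $ i"
    and d: "\<And>j t. j < M + 2 \<Longrightarrow> t \<in> {0..T} \<Longrightarrow> (d j has_real_derivative d (Suc j) t) (at t within {0..T})"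
    and dcont: "continuous_on {0..T} (d (M + 2))"
    by blast
  have "bounded (d (M + 2) ` {0..T})"
    by (intro compact_imp_bounded compact_continuous_image dcont) auto
  then obtain Kd where "\<forall>y\<in>d (M + 2) ` {0..T}. norm y \<le> Kd"
    by (auto simp only: bounded_iff)
  then have Kd: "\<And>t. t \<in> {0..T} \<Longrightarrow> \<bar>d (M + 2) t\<bar> \<le> Kd" by force
  have Kd0: "0 \<le> Kd" using Kd[of 0] T by (auto intro: order_trans[OF abs_ge_zero])
  define Ct where "Ct = Kd * (2 * real M ^ (M + 2) + (\<Sum>m=0..M. \<bar>AM_beta M m\<bar>) * real M ^ (M + 1))"
  have Ct: "0 \<le> Ct" unfolding Ct_def by (intro mult_nonneg_nonneg add_nonneg_nonneg sum_nonneg Kd0) auto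
  from AM_node_error_bound[OF \<theta> roots] obtain K where K: "0 \<le> K"
    and nodes: "\<forall>N (e :: nat \<Rightarrow> real) \<tau>. M \<le> N \<longrightarrow> 0 \<le> \<tau>
      \<longrightarrow> (\<forall>n\<in>{M..N}. \<bar>\<Sum>m=0..M. AM_beta M m * e (n - m)\<bar> \<le> \<tau>)
      \<longrightarrow> (\<forall>k\<le>N. \<bar>e k\<bar> \<le> K * (\<tau> + \<theta> ^ k * (\<Sum>j=0..<M. \<bar>e j\<bar>) + \<theta> ^ (N - k) * (\<Sum>j=N-M+1..N. \<bar>e j\<bar>)))"
    by (elim exE conjE)
  define C1 where "C1 = real M ^ M * real (M + 1) * (K * (1 + Ct)) * (1 / \<theta>) ^ M"
  define C2 where "C2 = (1 + real (M + 1) * real M ^ M) * real M ^ M * real (2 * M + 1)"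
  have C12: "0 \<le> C1" "0 \<le> C2" using K Ct \<theta> by (auto simp: C1_def C2_def)
  show ?thesis
  proof (intro exI[of _ "C1 + C2 + 1"] conjI allI impI ballI)
    show "0 < C1 + C2 + 1" using C12 by simp
    fix N n0 n1 :: nat and R :: real and u
    assume N: "M \<le> N" and R: "0 < R" and u: "u \<in> trace_class T (M + 1) x f A R"
      and loss: "AM_loss M T N x i u = 0" and n: "n0 \<le> n1" "n1 \<le> N"
    define h where "h = step T N"
    have h: "0 < h" and NT: "real N * h = T" using T M N by (auto simp: h_def step_def)
    have node: "node T N k = real k * h" for k by (simp add: node_def h_def)
    have node_in: "real k * h \<in> {0..T}" if "k \<le> N" for k
      using that h unfolding NT[symmetric] by (auto intro: mult_right_mono)
    define g where "g t = u (x t) - f (x t)" for t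
    have g: "continuous_on {0..T} g"
      unfolding g_def using u A f
      by (intro trace_error_continuous[OF T ode Ck[unfolded add_2_eq_Suc'] dom]) (auto simp: trace_class_def)
    define v where "v = (SOME v. has_weak_deriv 0 T (M + 1) g v)"
    have "\<exists>v. has_weak_deriv 0 T (M + 1) g v"
      using u by (auto simp: trace_class_def sobolev_W1_def g_def[abs_def])
    then have wd: "has_weak_deriv 0 T (M + 1) g v" unfolding v_def by (rule someI_ex)
    have v: "v absolutely_integrable_on {0..T}"
      using wd by (simp add: has_weak_deriv_def absolutely_integrable_on_def integrable_on_open_interval_real)
    have vR: "integral {0..T} (\<lambda>t. \<bar>v t\<bar>) \<le> R"
      using u by (simp add: trace_class_def sobolev_seminorm_def v_def g_def[abs_def] integral_open_interval_real)
    have residual: "\<bar>\<Sum>m=0..M. AM_beta M m * g (real (n - m) * h)\<bar> \<le> Ct * h ^ (M + 1)" if n: "n \<in> {M..N}" for n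
    proof -
      let ?r = "\<lambda>n. (\<Sum>m=0..M. AM_beta M m * u (x (node T N (n - m))))
          - inverse (step T N) * (\<Sum>m=0..M. AM_alpha m * (x (node T N (n - m)) $ i))"
      have "(\<Sum>n=M..N. \<bar>?r n\<bar>\<^sup>2) = 0"
        using loss by (simp add: AM_loss_def)
      then have "?r n = 0" using n by (subst (asm) sum_nonneg_eq_0_iff) auto
      moreover have "(\<Sum>m=0..M. AM_alpha m * (x (node T N (n - m)) $ i))
          = x (node T N n) $ i - x (node T N (n - 1)) $ i"
      proof -
        have "(\<Sum>m=0..M. AM_alpha m * (x (node T N (n - m)) $ i))
            = (\<Sum>m\<in>{0,1}. AM_alpha m * (x (node T N (n - m)) $ i))"
          using M by (intro sum.mono_neutral_right) (auto simp: AM_alpha_def)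
        then show ?thesis by (simp add: AM_alpha_def)
      qed
      moreover have "x (node T N n) $ i = d 0 (real n * h)" "x (node T N (n - 1)) $ i = d 0 (real (n - 1) * h)"
        using d0[OF node_in[of n]] d0[OF node_in[of "n - 1"]] n by (auto simp: node)
      ultimately have U: "(\<Sum>m=0..M. AM_beta M m * u (x (real (n - m) * h)))
          = (d 0 (real n * h) - d 0 (real (n - 1) * h)) / h"
        by (simp add: h_def[symmetric] node divide_inverse mult.commute)
      let ?a = "real (n - M) * h"
      have grid: "?a + real M * h = real n * h" "?a + (real M - 1) * h = real (n - 1) * h"
        "\<And>m. m \<le> M \<Longrightarrow> ?a + real (M - m) * h = real (n - m) * h"
        using n M by (auto simp: of_nat_diff algebra_simps)
      have "?a + real M * h \<le> T" unfolding grid using node_in[of n] n by auto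
      from AM_truncation_error[OF M h _ this d Kd]
      have "\<bar>(d 0 (real n * h) - d 0 (real (n - 1) * h)) / h
          - (\<Sum>m=0..M. AM_beta M m * d 1 (?a + real (M - m) * h))\<bar> \<le> Ct * h ^ (M + 1)"
        unfolding grid Ct_def using h by simp
      moreover have "(\<Sum>m=0..M. AM_beta M m * d 1 (?a + real (M - m) * h))
          = (\<Sum>m=0..M. AM_beta M m * f (x (real (n - m) * h)))"
      proof (rule sum.cong[OF refl])
        fix m assume "m \<in> {0..M}"
        then have "d 1 (?a + real (M - m) * h) = d 1 (real (n - m) * h)" using grid(3)[of m] by simp
        also have "\<dots> = f (x (real (n - m) * h))" using n unfolding f by (intro d1 node_in) auto
        finally show "AM_beta M m * d 1 (?a + real (M - m) * h) = AM_beta M m * f (x (real (n - m) * h))" by simp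
      qed
      ultimately show ?thesis
        unfolding U[symmetric] by (simp add: g_def right_diff_distrib sum_subtractf)
    qed
    define E0 where "E0 = err_0 M T N x f u"
    define ET where "ET = err_T M T N x f u"
    have E: "E0 = (\<Sum>j=0..<M. \<bar>g (real j * h)\<bar>)" "ET = (\<Sum>j=N-M+1..N. \<bar>g (real j * h)\<bar>)"
      by (simp_all add: E0_def ET_def err_0_def err_T_def node g_def)
    have nnE: "0 \<le> E0" "0 \<le> ET" by (auto simp: E intro: sum_nonneg)
    have hp: "0 \<le> h ^ (M + 1)" using h by simp
    have node_bd: "\<bar>g (real k * h)\<bar> \<le> (K * (1 + Ct)) * (h ^ (M + 1) + \<theta> ^ k * E0 + \<theta> ^ (N - k) * ET)" if "k \<le> N" for k
    proof -
      have "\<bar>g (real k * h)\<bar> \<le> K * (Ct * h ^ (M + 1) + \<theta> ^ k * E0 + \<theta> ^ (N - k) * ET)"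
        unfolding E by (rule nodes[rule_format, where e = "\<lambda>j. g (real j * h)"])
          (use N Ct hp residual that in \<open>auto intro!: mult_nonneg_nonneg\<close>)
      also have "\<dots> \<le> K * ((1 + Ct) * h ^ (M + 1) + (1 + Ct) * (\<theta> ^ k * E0) + (1 + Ct) * (\<theta> ^ (N - k) * ET))"
        using K Ct hp nnE \<theta> by (intro mult_left_mono add_mono) (auto simp: algebra_simps)
      finally show ?thesis by (simp add: algebra_simps)
    qed
    let ?S = "\<Sum>k=n0..<n1. h ^ (M + 1) + \<theta> ^ k * E0 + \<theta> ^ (N - k) * ET"
    have S: "0 \<le> ?S" using hp nnE \<theta> by (intro sum_nonneg) auto
    have "integral {real n0 * h..real n1 * h} (\<lambda>t. \<bar>g t\<bar>)
        \<le> C1 * (h * ?S) + C2 * h ^ (M + 1) * integral {0..real N * h} (\<lambda>t. \<bar>v t\<bar>)"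
      unfolding C1_def C2_def
      by (rule integral_bound_from_nodes[OF M N h \<theta> _ hp nnE])
        (use K Ct g wd v NT node_bd n in auto)
    also have "\<dots> \<le> C1 * (h * ?S) + C2 * h ^ (M + 1) * R"
      using C12 h vR NT by (intro add_left_mono mult_left_mono) auto
    also have "\<dots> \<le> (C1 + C2 + 1) * (h * ?S) + (C1 + C2 + 1) * (h ^ (M + 1) * R)"
      using C12 h S R unfolding mult.assoc by (intro add_mono mult_right_mono) auto
    finally show "integral {node T N n0..node T N n1} (\<lambda>t. \<bar>u (x t) - f (x t)\<bar>)
        \<le> (C1 + C2 + 1) * (step T N * (\<Sum>k=n0..<n1. step T N ^ (M + 1) + \<theta> ^ k * err_0 M T N x f u + \<theta> ^ (N - k) * err_T M T N x f u)
           + step T N ^ (M + 1) * R)"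
      unfolding node g_def h_def[symmetric] E0_def[symmetric] ET_def[symmetric] by (simp only: distrib_left)
  qed
qed

section \<open>The error estimates\<close>

theorem theorem4p5:
  fixes x :: "real \<Rightarrow> real ^ 'd" and x_init :: "real ^ 'd"
    and F :: "real ^ 'd \<Rightarrow> real ^ 'd" and f :: "real ^ 'd \<Rightarrow> real" and i :: 'd
    and T :: real and M p :: nat
    and \<Omega> :: "(real ^ 'd) set" and A :: "(real ^ 'd \<Rightarrow> real) set"
  assumes "T > 0" and "M \<ge> 1" and "p = M + 1"
    and "\<And>t. t \<in> {0..T} \<Longrightarrow> (x has_vector_derivative F (x t)) (at t within {0..T})"
    and "x 0 = x_init"
    and "Ck_on (p + 1) {0..T} x"
    and "f = (\<lambda>y. F y $ i)"
    and "x ` {0..T} \<subseteq> interior \<Omega>"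
    and "A \<subseteq> {u. continuous_on \<Omega> u}"
    and "\<And>z. cmod z = 1 \<Longrightarrow> poly (AM_poly M) z \<noteq> 0"
  shows
    "(\<exists>C_M>0. \<forall>N\<ge>M. \<forall>R>0. \<forall>u \<in> trace_class T p x f A R.
        AM_loss M T N x i u = 0 \<longrightarrow>
        integral {0..T} (\<lambda>t. \<bar>u (x t) - f (x t)\<bar>)
          \<le> C_M * (step T N * (err_0 M T N x f u + err_T M T N x f u)
                   + step T N ^ p + step T N ^ p * R))
   \<and> (\<exists>C>0. \<forall>\<theta>\<in>{AM_rho M<..<1}. \<exists>C_M\<theta>>0. \<forall>R>0. \<forall>u :: nat \<Rightarrow> real ^ 'd \<Rightarrow> real.
        (\<forall>N\<ge>M. u N \<in> trace_class T p x f A R \<and> AM_loss M T N x i (u N) = 0)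
        \<and> Bseq (\<lambda>N. err_0 M T N x f (u N)) \<and> Bseq (\<lambda>N. err_T M T N x f (u N)) \<longrightarrow>
        (\<forall>\<delta>\<in>{0<..<T/2}. \<exists>h_hat>0. \<forall>N\<ge>M. step T N < h_hat \<longrightarrow>
           integral {\<delta>..T - \<delta>} (\<lambda>t. \<bar>u N (x t) - f (x t)\<bar>)
             \<le> C_M\<theta> * (C + R) * step T N ^ p))"
proof -
  have dom: "x ` {0..T} \<subseteq> \<Omega>" using assms(8) interior_subset by blast
  have err_nn: "0 \<le> err_0 M T N x f u" "0 \<le> err_T M T N x f u" for N u
    by (auto simp: err_0_def err_T_def intro: sum_nonneg)
  have estimate: "\<exists>C>0. \<forall>N\<ge>M. \<forall>R>0. \<forall>u\<in>trace_class T p x f A R. AM_loss M T N x i u = 0 \<longrightarrow>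
    (\<forall>n0 n1. n0 \<le> n1 \<longrightarrow> n1 \<le> N \<longrightarrow>
      integral {node T N n0..node T N n1} (\<lambda>t. \<bar>u (x t) - f (x t)\<bar>)
      \<le> C * (step T N * (\<Sum>k=n0..<n1. step T N ^ p + \<theta> ^ k * err_0 M T N x f u + \<theta> ^ (N - k) * err_T M T N x f u)
           + step T N ^ p * R))"
    if \<theta>: "\<theta> \<in> {AM_rho M<..<1}" for \<theta>
    unfolding assms(3)
  proof (rule zero_residual_integral_bound[OF assms(1,2,4) _ assms(7) dom assms(9)])
    show "Ck_on (M + 2) {0..T} x" using assms(3,6) by simp
    show "0 < \<theta>" "\<theta> < 1" using \<theta> AM_rho_nonneg[of M] by auto
    show "\<forall>z. poly (AM_poly M) z = 0 \<longrightarrow> cmod z < \<theta> \<or> z \<noteq> 0 \<and> inverse (cmod z) < \<theta>"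
      using \<theta> by (intro AM_roots_separated assms(10)) auto
  qed
  have grid: "real N * step T N = T" "0 < step T N" if "M \<le> N" for N
    using that assms(1,2) by (auto simp: step_def)
  have global: "\<exists>C_M>0. \<forall>N\<ge>M. \<forall>R>0. \<forall>u \<in> trace_class T p x f A R.
        AM_loss M T N x i u = 0 \<longrightarrow>
        integral {0..T} (\<lambda>t. \<bar>u (x t) - f (x t)\<bar>)
          \<le> C_M * (step T N * (err_0 M T N x f u + err_T M T N x f u)
                   + step T N ^ p + step T N ^ p * R)"
  proof -
    \<comment> \<open>Any rate in the open interval serves, since the boundary layers are summed over the whole grid.\<close>
    define \<theta> where "\<theta> = (AM_rho M + 1) / 2"
    have \<theta>: "\<theta> \<in> {AM_rho M<..<1}" "0 < \<theta>" "\<theta> < 1"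
      using AM_rho_less_1[of M] AM_rho_nonneg[of M] by (auto simp: \<theta>_def)
    from estimate[OF \<theta>(1)] obtain C where C: "C > 0" and bound:
      "\<forall>N\<ge>M. \<forall>R>0. \<forall>u\<in>trace_class T p x f A R. AM_loss M T N x i u = 0 \<longrightarrow>
        (\<forall>n0 n1. n0 \<le> n1 \<longrightarrow> n1 \<le> N \<longrightarrow> integral {node T N n0..node T N n1} (\<lambda>t. \<bar>u (x t) - f (x t)\<bar>)
        \<le> C * (step T N * (\<Sum>k=n0..<n1. step T N ^ p + \<theta> ^ k * err_0 M T N x f u + \<theta> ^ (N - k) * err_T M T N x f u)
           + step T N ^ p * R))"
      by (elim exE conjE)
    define G where "G = T + 1 / (1 - \<theta>) + 1"
    have G: "1 \<le> G" "T \<le> G" "1 / (1 - \<theta>) \<le> G" using assms(1) \<theta> by (auto simp: G_def)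
    show ?thesis
    proof (intro exI[of _ "C * G"] conjI allI impI ballI)
      show "0 < C * G" using C G by simp
      fix N :: nat and R :: real and u
      assume N: "M \<le> N" and R: "0 < R" and u: "u \<in> trace_class T p x f A R" "AM_loss M T N x i u = 0"
      define h E0 ET where "h = step T N" and "E0 = err_0 M T N x f u" and "ET = err_T M T N x f u"
      have h: "0 < h" "real N * h = T" using grid[OF N] by (auto simp: h_def)
      have nn: "0 \<le> E0" "0 \<le> ET" using err_nn by (auto simp: E0_def ET_def)
      have geom: "(\<Sum>k=0..<N. \<theta> ^ k) \<le> 1 / (1 - \<theta>)" "(\<Sum>k=0..<N. \<theta> ^ (N - k)) \<le> 1 / (1 - \<theta>)"
      proof -
        show 1: "(\<Sum>k=0..<N. \<theta> ^ k) \<le> 1 / (1 - \<theta>)"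
          using geometric_convolution_le[of \<theta> 1 N] \<theta>
            sum.nat_diff_reindex[of "\<lambda>k. \<theta> ^ k" N] by (simp add: atLeast0LessThan)
        have "(\<Sum>k=0..<N. \<theta> ^ (N - k)) \<le> (\<Sum>k=0..<N. \<theta> ^ (N - Suc k))"
          using \<theta> by (intro sum_mono power_decreasing) auto
        also have "\<dots> \<le> 1 / (1 - \<theta>)"
          using geometric_convolution_le[of \<theta> 1 N] \<theta> by (simp add: atLeast0LessThan)
        finally show "(\<Sum>k=0..<N. \<theta> ^ (N - k)) \<le> 1 / (1 - \<theta>)" .
      qed
      have "integral {0..T} (\<lambda>t. \<bar>u (x t) - f (x t)\<bar>)
          \<le> C * (h * (\<Sum>k=0..<N. h ^ p + \<theta> ^ k * E0 + \<theta> ^ (N - k) * ET) + h ^ p * R)"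
        using bound[rule_format, OF N R u, of 0 N] h by (simp add: h_def E0_def ET_def node_def)
      also have "h * (\<Sum>k=0..<N. h ^ p + \<theta> ^ k * E0 + \<theta> ^ (N - k) * ET)
          = T * h ^ p + h * ((\<Sum>k=0..<N. \<theta> ^ k) * E0 + (\<Sum>k=0..<N. \<theta> ^ (N - k)) * ET)"
      proof -
        have "(\<Sum>k=0..<N. h ^ p + \<theta> ^ k * E0 + \<theta> ^ (N - k) * ET)
            = real N * h ^ p + (\<Sum>k=0..<N. \<theta> ^ k) * E0 + (\<Sum>k=0..<N. \<theta> ^ (N - k)) * ET"
          by (simp add: sum.distrib flip: sum_distrib_right)
        then show ?thesis unfolding h(2)[symmetric] by (simp add: algebra_simps)
      qed
      also have "C * (\<dots> + h ^ p * R) \<le> C * ((G * h ^ p + h * (G * E0 + G * ET)) + G * (h ^ p * R))"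
      proof (intro mult_left_mono add_mono mult_right_mono)
        show "h ^ p * R \<le> G * (h ^ p * R)" using mult_right_mono[OF G(1), of "h ^ p * R"] h R by simp
      qed (use C G h nn geom in auto)
      also have "\<dots> = C * G * (h * (E0 + ET) + h ^ p + h ^ p * R)" by (simp add: algebra_simps)
      finally show "integral {0..T} (\<lambda>t. \<bar>u (x t) - f (x t)\<bar>)
          \<le> C * G * (step T N * (err_0 M T N x f u + err_T M T N x f u) + step T N ^ p + step T N ^ p * R)"
        by (simp only: h_def E0_def ET_def)
    qed
  qed
  have interior: "\<exists>C_M\<theta>>0. \<forall>R>0. \<forall>u :: nat \<Rightarrow> real ^ 'd \<Rightarrow> real.
        (\<forall>N\<ge>M. u N \<in> trace_class T p x f A R \<and> AM_loss M T N x i (u N) = 0)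
        \<and> Bseq (\<lambda>N. err_0 M T N x f (u N)) \<and> Bseq (\<lambda>N. err_T M T N x f (u N)) \<longrightarrow>
        (\<forall>\<delta>\<in>{0<..<T/2}. \<exists>h_hat>0. \<forall>N\<ge>M. step T N < h_hat \<longrightarrow>
           integral {\<delta>..T - \<delta>} (\<lambda>t. \<bar>u N (x t) - f (x t)\<bar>)
             \<le> C_M\<theta> * (1 + R) * step T N ^ p)"
    if \<theta>1: "\<theta> \<in> {AM_rho M<..<1}" for \<theta>
  proof -
    have \<theta>: "0 < \<theta>" "\<theta> < 1" using \<theta>1 AM_rho_nonneg[of M] by auto
    from estimate[OF \<theta>1] obtain C where C: "C > 0" and bound:
      "\<forall>N\<ge>M. \<forall>R>0. \<forall>u\<in>trace_class T p x f A R. AM_loss M T N x i u = 0 \<longrightarrow>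
        (\<forall>n0 n1. n0 \<le> n1 \<longrightarrow> n1 \<le> N \<longrightarrow> integral {node T N n0..node T N n1} (\<lambda>t. \<bar>u (x t) - f (x t)\<bar>)
        \<le> C * (step T N * (\<Sum>k=n0..<n1. step T N ^ p + \<theta> ^ k * err_0 M T N x f u + \<theta> ^ (N - k) * err_T M T N x f u)
           + step T N ^ p * R))"
      by (elim exE conjE)
    show ?thesis
    proof (rule exI[of _ "C * (3 * T + 1)"], intro conjI allI impI ballI)
      show "0 < C * (3 * T + 1)" using C assms(1) by simp
      fix R \<delta> :: real and u :: "nat \<Rightarrow> real ^ 'd \<Rightarrow> real"
      assume R: "0 < R" and u: "(\<forall>N\<ge>M. u N \<in> trace_class T p x f A R \<and> AM_loss M T N x i (u N) = 0)
        \<and> Bseq (\<lambda>N. err_0 M T N x f (u N)) \<and> Bseq (\<lambda>N. err_T M T N x f (u N))"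
        and \<delta>: "\<delta> \<in> {0<..<T/2}"
      from u obtain B0 BT where B0: "0 < B0" "\<And>N. norm (err_0 M T N x f (u N)) \<le> B0"
        and BT: "0 < BT" "\<And>N. norm (err_T M T N x f (u N)) \<le> BT"
        unfolding Bseq_def by blast
      define B where "B = max B0 BT"
      have B: "0 \<le> B" "err_0 M T N x f (u N) \<le> B" "err_T M T N x f (u N) \<le> B" for N
        using B0(1) BT(1) abs_ge_self[THEN order_trans, OF B0(2)[unfolded real_norm_def, of N]]
          abs_ge_self[THEN order_trans, OF BT(2)[unfolded real_norm_def, of N]]
        unfolding B_def by linarith+
      obtain h0 where h0: "0 < h0"
        "\<And>h n. 0 < h \<Longrightarrow> h < h0 \<Longrightarrow> \<delta> / h - 1 \<le> real n \<Longrightarrow> \<theta> ^ n * B \<le> h ^ p"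
        using geometric_dominated_by_step_power[OF \<theta> _ _ B(1), of \<delta> p] \<delta> assms(3) by auto
      show "\<exists>h_hat>0. \<forall>N\<ge>M. step T N < h_hat \<longrightarrow>
           integral {\<delta>..T - \<delta>} (\<lambda>t. \<bar>u N (x t) - f (x t)\<bar>) \<le> C * (3 * T + 1) * (1 + R) * step T N ^ p"
      proof (intro exI[of _ h0] conjI allI impI)
        show "0 < h0" by fact
        fix N assume N: "M \<le> N" and small: "step T N < h0"
        define h where "h = step T N"
        have h: "0 < h" "real N * h = T" using grid[OF N] by (auto simp: h_def)
        \<comment> \<open>The first \<open>n0\<close> and the last \<open>n0\<close> cells lie in the excluded boundary strips, and \<open>n0\<close> is at least \<open>\<delta> / h - 1\<close>.\<close>
        define n0 where "n0 = nat \<lfloor>\<delta> / h\<rfloor>"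
        have "real n0 = of_int \<lfloor>\<delta> / h\<rfloor>" using \<delta> h by (simp add: n0_def)
        then have n0: "real n0 \<le> \<delta> / h" "\<delta> / h - 1 \<le> real n0" by linarith+
        have n0h: "real n0 * h \<le> \<delta>" using n0(1) h by (simp add: field_simps)
        have "2 * real n0 * h < real N * h" using n0h \<delta> h by simp
        then have "2 * real n0 < real N" using h(1) by (rule mult_right_less_imp_less[OF _ less_imp_le])
        then have n0N: "2 * n0 \<le> N" by linarith
        have right: "T - \<delta> \<le> real (N - n0) * h"
          using n0h n0N h by (simp add: of_nat_diff algebra_simps)
        let ?\<phi> = "\<lambda>t. \<bar>u N (x t) - f (x t)\<bar>"
        have decay: "\<theta> ^ k * B \<le> h ^ p" if "n0 \<le> k" for k
        proof -
          have "\<theta> ^ k * B \<le> \<theta> ^ n0 * B"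
            using that \<theta> B(1) by (intro mult_right_mono power_decreasing) auto
          also have "\<dots> \<le> h ^ p" using h0(2) h small n0(2) by (simp add: h_def)
          finally show ?thesis .
        qed
        have "continuous_on {0..T} (\<lambda>t. u N (x t) - f (x t))"
        proof (rule trace_error_continuous[OF assms(1,4) _ dom _ assms(7)])
          show "Ck_on (Suc (Suc M)) {0..T} x" using assms(3,6) by simp
          show "continuous_on \<Omega> (u N)" using u N assms(9) by (auto simp: trace_class_def)
        qed
        then have int: "?\<phi> integrable_on {0..T}"
          by (intro integrable_continuous_interval continuous_on_rabs)
        have "integral {\<delta>..T - \<delta>} ?\<phi> \<le> integral {node T N n0..node T N (N - n0)} ?\<phi>"
        proof (rule integral_subset_le)
          have "real (N - n0) * h \<le> T" unfolding h(2)[symmetric] using h by (intro mult_right_mono) auto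
          then show "?\<phi> integrable_on {node T N n0..node T N (N - n0)}"
            using h by (intro integrable_on_subinterval[OF int]) (auto simp: node_def h_def)
          show "?\<phi> integrable_on {\<delta>..T - \<delta>}"
            using \<delta> by (intro integrable_on_subinterval[OF int]) auto
        qed (use n0h right in \<open>auto simp: node_def h_def\<close>)
        also have "\<dots> \<le> C * (h * (\<Sum>k=n0..<N-n0. h ^ p + \<theta> ^ k * err_0 M T N x f (u N) + \<theta> ^ (N - k) * err_T M T N x f (u N)) + h ^ p * R)"
          unfolding h_def using u N R n0N by (intro bound[rule_format]) auto
        also have "\<dots> \<le> C * (3 * T * h ^ p + h ^ p * R)"
        proof -
          have "(\<Sum>k=n0..<N-n0. h ^ p + \<theta> ^ k * err_0 M T N x f (u N) + \<theta> ^ (N - k) * err_T M T N x f (u N))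
              \<le> (\<Sum>k=n0..<N-n0. 3 * h ^ p)"
          proof (rule sum_mono)
            fix k assume k: "k \<in> {n0..<N - n0}"
            have "\<theta> ^ k * err_0 M T N x f (u N) \<le> \<theta> ^ k * B" "\<theta> ^ (N - k) * err_T M T N x f (u N) \<le> \<theta> ^ (N - k) * B"
              using B(2,3)[of N] \<theta> by (auto intro!: mult_left_mono)
            moreover have "\<theta> ^ k * B \<le> h ^ p" "\<theta> ^ (N - k) * B \<le> h ^ p" using k by (auto intro!: decay)
            ultimately show "h ^ p + \<theta> ^ k * err_0 M T N x f (u N) + \<theta> ^ (N - k) * err_T M T N x f (u N) \<le> 3 * h ^ p"
              by linarith
          qed
          also have "\<dots> \<le> real N * (3 * h ^ p)" using h by (simp add: mult_right_mono)
          finally have "h * (\<Sum>k=n0..<N-n0. h ^ p + \<theta> ^ k * err_0 M T N x f (u N) + \<theta> ^ (N - k) * err_T M T N x f (u N))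
              \<le> h * (real N * (3 * h ^ p))"
            using h by (intro mult_left_mono) auto
          also have "\<dots> = 3 * T * h ^ p" unfolding h(2)[symmetric] by simp
          finally show ?thesis using C by (intro mult_left_mono add_right_mono) auto
        qed
        also have "\<dots> \<le> C * ((3 * T + 1) * h ^ p + ((3 * T + 1) * (h ^ p * R)))"
          using C h R assms(1) by (intro mult_left_mono add_mono) (auto simp: algebra_simps)
        also have "\<dots> = C * (3 * T + 1) * (1 + R) * h ^ p" by (simp add: algebra_simps)
        finally show "integral {\<delta>..T - \<delta>} ?\<phi> \<le> C * (3 * T + 1) * (1 + R) * step T N ^ p"
          by (simp only: h_def)
      qed
    qed
  qed
  show ?thesis
    by (rule conjI[OF global], rule exI[of _ 1], intro conjI zero_less_one ballI) (rule interior)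
qed

end
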